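(* Let $G$ be a finite simple graph with $n\ge 1$ vertices, let $-\infty<\alpha<\infty$ and $-\infty\le\beta<\infty$, and let $\xi(t)$ be the continuous-time Markov chain (CTMC) with parameters $\alpha,\beta,G$ described in the context. Let $\lambda_1(G)$ be the largest eigenvalue of the adjacency matrix of $G$, $e(G)$ the number of edges of $G$, and $\nu_i$ the degree of vertex $i$. (i) $\xi(t)$ is non-explosive in the following cases: (a) $\alpha<0$ and $\alpha+\beta\lambda_1(G)\le 0$; (b) $\alpha=0$ and $\beta\le 0$; (c) $\alpha=0$, $\beta>0$ and $e(G)=0$. (ii) $\xi(t)$ explodes almost surely in the following cases: (a) $\alpha>0$; (b) $\alpha=0$, $\beta>0$ and $e(G)>0$; (c) $\alpha<0$ and $\alpha+\beta\min_i\nu_i>0$.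
   Context: $G$ is a finite undirected graph, not necessarily connected, with vertices $1,\dots,n$ and without self-loops or multiple edges; $A$ is its adjacency matrix, and $i\sim j$ means that $i$ and $j$ are adjacent. $\mathbb{Z}_+=\{0,1,2,\dots\}$ and $\mathbf e_i$ is the $i$-th unit vector. The CTMC $\xi(t)=(\xi_1(t),\dots,\xi_n(t))\in\mathbb{Z}_+^n$ has transition rates $q_{\xi,\eta}$ given by $$q_{\xi,\xi+\mathbf e_i}=e^{\alpha\xi_i+\beta(A\xi)_i}=e^{\alpha\xi_i+\beta\sum_{j:\,j\sim i}\xi_j},\qquad q_{\xi,\xi-\mathbf e_i}=1 \ \text{ if } \xi_i>0,$$ and all other rates are $0$. Case $\beta=-\infty$ (hard-core interaction): the conventions $0\cdot\infty=0$ and $e^{-\infty}=0$ are used, so $\xi_i$ can increase only when $\xi_j=0$ for all $j\sim i$. In this case the chain is considered on the state space $\Gamma_0=\{\xi\in\mathbb{Z}_+^n:\ \xi_i\xi_j=0 \text{ whenever } i\sim j\}$, which is absorbing and on which the chain is irreducible. The convention $0\cdot\infty=0$ also applies to $\beta\lambda_1(G)$ and $\beta\min_i\nu_i$. The chain explodes if it makes infinitely many jumps in finite time. Equivalently, with $q_\xi=\sum_\eta q_{\xi,\eta}$ and $\zeta(t)$, $t=0,1,2,\dots$, the embedded jump chain, the chain explodes almost surely iff $\sum_t q_{\zeta(t)}^{-1}<\infty$ almost surely, and is non-explosive iff $\sum_t q_{\zeta(t)}^{-1}=\infty$ almost surely. *)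

theory Defs
  imports "HOL-Probability.Probability"
begin

(* A graph on the vertex type 'n is given by its set of edges, each edge being a two-element set
   of vertices; this excludes loops and multiple edges. *)
definition simple_graph :: "'n set set \<Rightarrow> bool" where
  "simple_graph E \<longleftrightarrow> (\<forall>e\<in>E. card e = 2)"

definition adjacent :: "'n set set \<Rightarrow> 'n \<Rightarrow> 'n \<Rightarrow> bool" where
  "adjacent E i j \<longleftrightarrow> {i, j} \<in> E"

definition edge_number :: "'n::finite set set \<Rightarrow> nat" where
  "edge_number E = card E"

definition vertex_degree :: "'n::finite set set \<Rightarrow> 'n \<Rightarrow> nat" where
  "vertex_degree E i = card {j. adjacent E i j}"

definition min_degree :: "'n::finite set set \<Rightarrow> nat" where
  "min_degree E = Min (range (vertex_degree E))"

definition adjacency_matrix :: "'n::finite set set \<Rightarrow> real^'n^'n" where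
  "adjacency_matrix E = (\<chi> i j. if adjacent E i j then 1 else 0)"

definition eigenvalue :: "real^'n^'n \<Rightarrow> real \<Rightarrow> bool" where
  "eigenvalue A k \<longleftrightarrow> (\<exists>v. v \<noteq> 0 \<and> A *v v = k *\<^sub>R v)"

definition largest_eigenvalue :: "'n::finite set set \<Rightarrow> real" where
  "largest_eigenvalue E = Max {k. eigenvalue (adjacency_matrix E) k}"

(* Z is the embedded jump chain and T the sequence of holding times of a minimal continuous-time
   Markov chain on the countable state space S with transition rates q x y for x \<noteq> y (q x x = 0),
   with arbitrary initial law: Z moves with probabilities q x y / q_x, where q_x is the total rate
   out of x, and given Z the holding times are independent, T k being exponential with rate q_(Z k).
   This is stated through the finite-dimensional laws of (Z, T).  The description is meant for
   rates with 0 < q_x < \<infinity> for all x in S (no absorbing states). *)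

definition total_rate :: "'s set \<Rightarrow> ('s \<Rightarrow> 's \<Rightarrow> real) \<Rightarrow> 's \<Rightarrow> real" where
  "total_rate S q x = (\<Sum>\<^sub>\<infinity>y\<in>S. q x y)"

definition ctmc ::
  "'w measure \<Rightarrow> 's set \<Rightarrow> ('s \<Rightarrow> 's \<Rightarrow> real) \<Rightarrow> (nat \<Rightarrow> 'w \<Rightarrow> 's) \<Rightarrow> (nat \<Rightarrow> 'w \<Rightarrow> real) \<Rightarrow> bool"
  where
  "ctmc M S q Z T \<longleftrightarrow>
     prob_space M \<and>
     (\<forall>k. Z k \<in> M \<rightarrow>\<^sub>M count_space S) \<and>
     (\<forall>k. T k \<in> borel_measurable M) \<and>
     (\<forall>k x t. (\<forall>i\<le>k. x i \<in> S \<and> 0 \<le> t i) \<longrightarrow>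
        measure M {w \<in> space M. \<forall>i\<le>k. Z i w = x i \<and> T i w > t i} =
          measure M {w \<in> space M. Z 0 w = x 0} *
          (\<Prod>i<k. q (x i) (x (Suc i)) / total_rate S q (x i)) *
          (\<Prod>i\<le>k. exp (- total_rate S q (x i) * t i)))"

(* the time of the (k+1)-st jump *)
definition jump_time :: "(nat \<Rightarrow> 'w \<Rightarrow> real) \<Rightarrow> nat \<Rightarrow> 'w \<Rightarrow> real" where
  "jump_time T k w = (\<Sum>i\<le>k. T i w)"

definition explosion :: "(nat \<Rightarrow> 'w \<Rightarrow> real) \<Rightarrow> 'w \<Rightarrow> bool" where
  "explosion T w \<longleftrightarrow> (\<exists>t. infinite {k. jump_time T k w \<le> t})"

definition explodes_almost_surely :: "'w measure \<Rightarrow> (nat \<Rightarrow> 'w \<Rightarrow> real) \<Rightarrow> bool" where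
  "explodes_almost_surely M T \<longleftrightarrow> (AE w in M. explosion T w)"

definition non_explosive :: "'w measure \<Rightarrow> (nat \<Rightarrow> 'w \<Rightarrow> real) \<Rightarrow> bool" where
  "non_explosive M T \<longleftrightarrow> (AE w in M. \<not> explosion T w)"

(* The parameter \<beta> ranges over [-\<infinity>, \<infinity>); multiplication on ereal satisfies 0 * \<infinity> = 0.
   exp_ext is the exponential with e^(-\<infinity>) = 0; the value at +\<infinity> is never used. *)
definition exp_ext :: "ereal \<Rightarrow> real" where
  "exp_ext x = (if x = -\<infinity> then 0 else exp (real_of_ereal x))"

definition birth_rate :: "real \<Rightarrow> ereal \<Rightarrow> 'n::finite set set \<Rightarrow> ('n \<Rightarrow> nat) \<Rightarrow> 'n \<Rightarrow> real" where
  "birth_rate \<alpha> \<beta> E \<xi> i =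
     exp_ext (ereal (\<alpha> * real (\<xi> i)) + \<beta> * ereal ((adjacency_matrix E *v (\<chi> j. real (\<xi> j))) $ i))"

(* For given \<xi> and \<eta> at most one summand is nonzero. *)
definition rate ::
  "real \<Rightarrow> ereal \<Rightarrow> 'n::finite set set \<Rightarrow> ('n \<Rightarrow> nat) \<Rightarrow> ('n \<Rightarrow> nat) \<Rightarrow> real" where
  "rate \<alpha> \<beta> E \<xi> \<eta> =
     (\<Sum>i\<in>UNIV. (if \<eta> = \<xi>(i := \<xi> i + 1) then birth_rate \<alpha> \<beta> E \<xi> i else 0)
             + (if \<xi> i > 0 \<and> \<eta> = \<xi>(i := \<xi> i - 1) then 1 else 0))"

definition state_space :: "ereal \<Rightarrow> 'n::finite set set \<Rightarrow> ('n \<Rightarrow> nat) set" where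
  "state_space \<beta> E =
     (if \<beta> = -\<infinity> then {\<xi>. \<forall>i j. adjacent E i j \<longrightarrow> \<xi> i * \<xi> j = 0} else UNIV)"

end

theory Submission
  imports Defs
begin

text \<open>Both halves rest on Lyapunov functions for the generator $G$ of the chain.

If some $f \ge 0$ satisfies $Gf \le -\varepsilon$ on the whole state space, then the expected
explosion time from $x$ is at most $f(x)/\varepsilon$, so the chain explodes
(\<open>explosion_criterion\<close>). If some $f \ge 0$ satisfies $Gf \le c f$ and the exit rates are bounded
wherever $f$ is bounded, then the expected discount $e^{-cJ}$ at the time $J$ of the $k$-th jump
tends to $0$ as $k$ grows, so the chain does not explode (\<open>non_explosion_criterion\<close>).
Both criteria are proved backwards along the path, conditioning on the first jumps; the
probabilistic input is that, given the path, the holding times are independent exponential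
variables (\<open>path_law\<close>).

Write $v_i = \alpha\xi_i + \beta(A\xi)_i$ for the logarithm of the birth rate at $i$.

Non-explosion. If the birth rates are bounded, $f = 1$ works. The only other case is
$\alpha < 0 < \beta$ with $\alpha + \beta\lambda_1 \le 0$. There the quadratic form
$Q(\xi) = -\xi^T(\alpha I + \beta A)\xi$ is positive semidefinite and $v = -\nabla Q/2$: a large
birth rate at $i$ means a steep decrease of $Q$ in direction $i$, which bounds $GQ$ above, and
$v_i^2 \le -\alpha Q$, so the rates are bounded where $Q$ is. Hence $f = 1 + Q/2$ works.

Explosion. Suppose first that some fixed set $V$ of vertices and some $\gamma > 0$ have the
property that in every configuration some $i \in V$ has birth rate at least $e^{\gamma\xi_i}$.
Then $f = 1 - \exp(-K\sum_{i\in V} e^{-\gamma\xi_i})$ works for large $K$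
(\<open>explodes_if_local_growth\<close>). This covers $\alpha > 0$ with $\beta \ge 0$ or $\beta = -\infty$, the
case $\alpha = 0 < \beta$ (with $V$ the ends of an edge) and the case
$\alpha < 0 < \alpha + \beta\min_i\nu_i$ (where a vertex of least occupancy has the required rate).

What remains is $\alpha > 0$ with $-\infty < \beta < 0$. Here the explosion time can be long: from
a configuration in which neighbours block each other, particles must die first, and this takes a
time of the order of $|\xi|$, the total number of particles. Once the largest $v_i$ is not too
negative, however, vertex $i$ has a probability bounded below of escaping to infinity before
anything else happens, because each birth at $i$ multiplies its rate by $e^\alpha$ and does not
help any other vertex. With $\varphi_i$ a lower estimate of this escape probability, the function
$f = (|\xi| + K)(1 - \max_i \varphi_i)$ has drift at most $-1/4$ (\<open>negative_drift\<close>).\<close>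

section \<open>Exponential holding times\<close>

lemma nn_integral_exponential_tail:
  fixes l s :: real
  assumes "0 < l" "0 \<le> s"
  shows "(\<integral>\<^sup>+t. ennreal (exponential_density l t) * indicator {s<..} t \<partial>lborel) = ennreal (exp (- l * s))"
proof -
  let ?D = "density lborel (exponential_density l)"
  interpret D: prob_space ?D
    using assms by (intro prob_space_exponential_density)
  have "distributed ?D lborel (\<lambda>t. t) (exponential_density l)"
    unfolding distributed_def by (auto simp: distr_id2)
  then have "\<P>(t in ?D. s < t) = exp (- s * l)"
    using assms by (intro D.exponential_distributedD_gt)
  moreover have "{t \<in> space ?D. s < t} = {s<..}"
    by auto
  ultimately have "emeasure ?D {s<..} = ennreal (exp (- l * s))"
    by (simp add: D.emeasure_eq_measure mult.commute)
  then show ?thesis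
    by (simp add: emeasure_density)
qed

lemma nn_integral_exponential_density:
  "0 < l \<Longrightarrow> (\<integral>\<^sup>+t. ennreal (exponential_density l t) \<partial>lborel) = 1"
  using nn_integral_erlang_ith_moment[of l 0 0] by simp

lemma nn_integral_exponential_mean:
  assumes "0 < l"
  shows "(\<integral>\<^sup>+t. ennreal (exponential_density l t) * ennreal t \<partial>lborel) = ennreal (1 / l)"
proof -
  have "(\<integral>\<^sup>+t. ennreal (exponential_density l t) * ennreal t \<partial>lborel)
      = (\<integral>\<^sup>+t. ennreal (exponential_density l t * t ^ 1) \<partial>lborel)"
    using assms by (intro nn_integral_cong) (simp add: ennreal_mult' exponential_density_nonneg)
  also have "\<dots> = ennreal (1 / l)"
    using nn_integral_erlang_ith_moment[of l 0 1] assms by simp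
  finally show ?thesis .
qed

lemma nn_integral_exponential_discount:
  assumes "0 < l" "0 \<le> c"
  shows "(\<integral>\<^sup>+t. ennreal (exponential_density l t) * ennreal (exp (- c * t)) \<partial>lborel) = ennreal (l / (l + c))"
proof -
  have "ennreal (exponential_density l t) * ennreal (exp (- c * t))
      = ennreal (l / (l + c)) * ennreal (exponential_density (l + c) t)" for t
  proof -
    have "exp (- t * (l + c)) = exp (- t * l) * exp (- c * t)"
      unfolding mult_exp_exp by (rule arg_cong[where f=exp]) (simp add: algebra_simps)
    then have "exponential_density l t * exp (- c * t) = l / (l + c) * exponential_density (l + c) t"
      using assms by (simp add: exponential_density_def)
    then show ?thesis
      using assms by (metis ennreal_mult' ennreal_mult'' exp_ge_zero exponential_density_nonneg
          add_pos_nonneg)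
  qed
  then have "(\<integral>\<^sup>+t. ennreal (exponential_density l t) * ennreal (exp (- c * t)) \<partial>lborel)
      = ennreal (l / (l + c)) * (\<integral>\<^sup>+t. ennreal (exponential_density (l + c) t) \<partial>lborel)"
    by (simp add: nn_integral_cmult)
  also have "\<dots> = ennreal (l / (l + c))"
    using assms by (simp add: nn_integral_exponential_density)
  finally show ?thesis .
qed

text \<open>Normalising the weight \<open>Y\<close> turns it into the density of a probability measure under which the
exponential tail identifies the law of \<open>X\<close>. Allowing a weight, not only an event, is what makes
it possible to integrate out several holding times one after the other in \<open>path_law\<close>.\<close>

lemma weighted_exponential_law:
  fixes X :: "'w \<Rightarrow> real" and Y :: "'w \<Rightarrow> ennreal" and g :: "real \<Rightarrow> ennreal"
  assumes [measurable]: "Y \<in> borel_measurable M" "X \<in> borel_measurable M"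
      "g \<in> borel_measurable borel"
    and pos: "AE w in M. 0 < X w" and l: "0 < l" and c: "c < \<infinity>"
    and tail: "\<And>s. 0 \<le> s \<Longrightarrow>
      (\<integral>\<^sup>+w. Y w * indicator {s<..} (X w) \<partial>M) = c * ennreal (exp (- l * s))"
  shows "(\<integral>\<^sup>+w. Y w * g (X w) \<partial>M) = c * (\<integral>\<^sup>+t. ennreal (exponential_density l t) * g t \<partial>lborel)"
proof -
  have total: "(\<integral>\<^sup>+w. Y w \<partial>M) = c"
  proof -
    have "(\<integral>\<^sup>+w. Y w \<partial>M) = (\<integral>\<^sup>+w. Y w * indicator {0<..} (X w) \<partial>M)"
      using pos by (intro nn_integral_cong_AE) (auto elim: eventually_mono)
    then show ?thesis
      using tail[of 0] by simp
  qed
  show ?thesis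
  proof (cases "c = 0")
    case True
    then have "AE w in M. Y w = 0"
      using total by (simp add: nn_integral_0_iff_AE)
    then have "(\<integral>\<^sup>+w. Y w * g (X w) \<partial>M) = (\<integral>\<^sup>+w. 0 \<partial>M)"
      by (intro nn_integral_cong_AE) (auto elim: eventually_mono)
    with True show ?thesis
      by simp
  next
    case False
    have cancel: "c * a / c = a" for a
      using False c ennreal_mult_divide_eq[of c a] by (metis mult.commute infinity_ennreal_def less_irrefl)
    define N where "N = density M (\<lambda>w. Y w / c)"
    have N_int: "(\<integral>\<^sup>+w. h w \<partial>N) = (\<integral>\<^sup>+w. Y w * h w \<partial>M) / c" if [measurable]: "h \<in> borel_measurable M" for h
    proof -
      have "(\<integral>\<^sup>+w. h w \<partial>N) = (\<integral>\<^sup>+w. (Y w * h w) / c \<partial>M)"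
        unfolding N_def by (subst nn_integral_density) (auto simp: divide_ennreal_def mult_ac)
      then show ?thesis
        by (simp add: nn_integral_divide)
    qed
    interpret N: prob_space N
    proof
      have "emeasure N (space N) = (\<integral>\<^sup>+w. 1 \<partial>N)"
        by simp
      also have "\<dots> = 1"
        by (subst N_int) (use total False c in \<open>simp_all add: ennreal_divide_self\<close>)
      finally show "emeasure N (space N) = 1" .
    qed
    have [measurable]: "X \<in> borel_measurable N"
      by (simp add: N_def)
    have gt: "measure N {w \<in> space N. a < X w} = exp (- a * l)" if "0 \<le> a" for a
    proof -
      have "emeasure N {w \<in> space N. a < X w}
          = (\<integral>\<^sup>+w. indicator {w \<in> space N. a < X w} w \<partial>N)"
        by (intro nn_integral_indicator[symmetric]) measurable
      also have "\<dots> = (\<integral>\<^sup>+w. indicator {a<..} (X w) \<partial>N)"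
        by (intro nn_integral_cong) (auto split: split_indicator)
      also have "\<dots> = c * ennreal (exp (- l * a)) / c"
        using tail[OF that] by (subst N_int) auto
      also have "\<dots> = ennreal (exp (- l * a))"
        using cancel .
      finally show ?thesis
        by (simp add: N.emeasure_eq_measure mult.commute)
    qed
    have "distributed N lborel X (exponential_density l)"
      unfolding N.exponential_distributed_iff[OF l]
    proof (intro conjI allI impI)
      fix a :: real assume a: "0 \<le> a"
      have "{w \<in> space N. X w \<le> a} = space N - {w \<in> space N. a < X w}"
        by auto
      then show "measure N {w \<in> space N. X w \<le> a} = 1 - exp (- a * l)"
        using gt[OF a] by (simp add: N.prob_compl)
    qed simp
    then have "(\<integral>\<^sup>+t. ennreal (exponential_density l t) * g t \<partial>lborel) = (\<integral>\<^sup>+w. g (X w) \<partial>N)"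
      by (rule distributed_nn_integral) simp
    also have "\<dots> = (\<integral>\<^sup>+w. Y w * g (X w) \<partial>M) / c"
      by (subst N_int) auto
    finally show ?thesis
      using cancel by (simp add: ennreal_times_divide)
  qed
qed

section \<open>Jump processes and their generator\<close>

definition succs :: "'s set \<Rightarrow> ('s \<Rightarrow> 's \<Rightarrow> real) \<Rightarrow> 's \<Rightarrow> 's set" where
  "succs S q x = {y \<in> S. q x y \<noteq> 0}"

definition generator :: "'s set \<Rightarrow> ('s \<Rightarrow> 's \<Rightarrow> real) \<Rightarrow> ('s \<Rightarrow> real) \<Rightarrow> 's \<Rightarrow> real" where
  "generator S q f x = (\<Sum>y\<in>succs S q x. q x y * (f y - f x))"

lemma total_rate_eq_sum_succs:
  "finite (succs S q x) \<Longrightarrow> total_rate S q x = (\<Sum>y\<in>succs S q x. q x y)"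
proof -
  assume "finite (succs S q x)"
  moreover have "total_rate S q x = (\<Sum>\<^sub>\<infinity>y\<in>succs S q x. q x y)"
    unfolding total_rate_def by (intro infsum_cong_neutral) (auto simp: succs_def)
  ultimately show ?thesis
    by simp
qed

locale jump_process =
  fixes M :: "'w measure" and S :: "'s set" and q :: "'s \<Rightarrow> 's \<Rightarrow> real"
    and Z :: "nat \<Rightarrow> 'w \<Rightarrow> 's" and T :: "nat \<Rightarrow> 'w \<Rightarrow> real"
  assumes ctmc: "ctmc M S q Z T"
    and countable_states: "countable S"
    and rates_nonneg: "x \<in> S \<Longrightarrow> y \<in> S \<Longrightarrow> 0 \<le> q x y"
    and finite_succs: "x \<in> S \<Longrightarrow> finite (succs S q x)"
    and exit_rate_pos: "x \<in> S \<Longrightarrow> 0 < total_rate S q x"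
begin

abbreviation exit_rate :: "'s \<Rightarrow> real" where
  "exit_rate \<equiv> total_rate S q"

definition cylinder :: "nat \<Rightarrow> (nat \<Rightarrow> 's) \<Rightarrow> 'w set" where
  "cylinder k x = {w \<in> space M. \<forall>i\<le>k. Z i w = x i}"

definition path_prob :: "nat \<Rightarrow> (nat \<Rightarrow> 's) \<Rightarrow> real" where
  "path_prob k x = measure M {w \<in> space M. Z 0 w = x 0} * (\<Prod>i<k. q (x i) (x (Suc i)) / exit_rate (x i))"

sublocale prob_space M
  using ctmc by (simp add: ctmc_def)

lemma Z_measurable [measurable]: "Z k \<in> M \<rightarrow>\<^sub>M count_space S"
  and T_measurable [measurable]: "T k \<in> borel_measurable M"
  using ctmc by (auto simp: ctmc_def)

lemma Z_in_states: "w \<in> space M \<Longrightarrow> Z k w \<in> S"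
  using measurable_space[OF Z_measurable] by simp

lemma finite_dim_law:
  assumes "\<And>i. i \<le> k \<Longrightarrow> x i \<in> S" "\<And>i. i \<le> k \<Longrightarrow> 0 \<le> t i"
  shows "measure M {w \<in> space M. \<forall>i\<le>k. Z i w = x i \<and> T i w > t i}
       = path_prob k x * (\<Prod>i\<le>k. exp (- exit_rate (x i) * t i))"
  using ctmc assms unfolding ctmc_def path_prob_def by blast

lemma exit_rate_eq: "x \<in> S \<Longrightarrow> exit_rate x = (\<Sum>y\<in>succs S q x. q x y)"
  by (simp add: total_rate_eq_sum_succs finite_succs)

lemma generator_eq:
  "x \<in> S \<Longrightarrow> generator S q f x = (\<Sum>y\<in>succs S q x. q x y * f y) - exit_rate x * f x"
  by (simp add: generator_def exit_rate_eq sum_subtractf sum_distrib_right right_diff_distrib)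

lemma succs_states: "y \<in> succs S q x \<Longrightarrow> y \<in> S"
  by (simp add: succs_def)

lemma Z_eq_measurable [measurable]: "{w \<in> space M. Z k w = a} \<in> sets M"
proof (cases "a \<in> S")
  case True
  then have "{w \<in> space M. Z k w = a} = Z k -` {a} \<inter> space M"
    by auto
  also have "\<dots> \<in> sets M"
    using True by (intro measurable_sets[OF Z_measurable]) auto
  finally show ?thesis .
next
  case False
  then have "{w \<in> space M. Z k w = a} = {}"
    using Z_in_states by auto
  then show ?thesis
    by simp
qed

lemma Z_eq_pred [measurable]: "Measurable.pred M (\<lambda>w. Z k w = a)"
  using Z_eq_measurable by (simp add: pred_def)

lemma cylinder_measurable [measurable]: "cylinder k x \<in> sets M"
  unfolding cylinder_def by measurable

lemma path_prob_nonneg: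
  assumes "\<And>i. i \<le> k \<Longrightarrow> x i \<in> S"
  shows "0 \<le> path_prob k x"
  unfolding path_prob_def
  by (intro mult_nonneg_nonneg prod_nonneg divide_nonneg_pos ballI)
    (use assms exit_rate_pos rates_nonneg in auto)

lemma path_prob_extend:
  "path_prob (Suc k) (x(Suc k := y)) = path_prob k x * (q (x k) y / exit_rate (x k))"
proof -
  have "(\<Prod>i<k. q ((x(Suc k := y)) i) ((x(Suc k := y)) (Suc i)) / exit_rate ((x(Suc k := y)) i))
      = (\<Prod>i<k. q (x i) (x (Suc i)) / exit_rate (x i))"
    by (intro prod.cong) auto
  then show ?thesis
    by (simp add: path_prob_def)
qed

text \<open>The finite-dimensional laws with all thresholds equal to \<open>0\<close> give the event \<open>A k x\<close>, that the path
starts with \<open>x\<close> and the first holding times are positive, the probability \<open>path_prob k x\<close>. Since the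
jump probabilities out of a state add up to \<open>1\<close>, the events obtained by prolonging \<open>x\<close> along the
transitions of positive rate exhaust \<open>A k x\<close> up to a null set. There are only countably many
finite paths.\<close>

lemma AE_regular_path:
  "AE w in M. \<forall>k. 0 < T k w \<and> Z (Suc k) w \<in> succs S q (Z k w)"
proof -
  define A where "A = (\<lambda>k x. {w \<in> space M. \<forall>i\<le>k. Z i w = x i \<and> 0 < T i w})"
  have [measurable]: "A k x \<in> sets M" for k x
    unfolding A_def by measurable
  have prob_A: "measure M (A k x) = path_prob k x" if "\<And>i. i \<le> k \<Longrightarrow> x i \<in> S" for k x
    using finite_dim_law[of k x "\<lambda>_. 0"] that by (simp add: A_def)
  have step: "AE w in M. w \<in> A k x \<longrightarrow> 0 < T (Suc k) w \<and> Z (Suc k) w \<in> succs S q (x k)"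
    if x: "\<And>i. i \<le> k \<Longrightarrow> x i \<in> S" for k x
  proof -
    define B where "B = (\<Union>y\<in>succs S q (x k). A (Suc k) (x(Suc k := y)))"
    have xk: "x k \<in> S"
      using x by simp
    have [measurable]: "B \<in> sets M"
      unfolding B_def using finite_succs[OF xk] by auto
    have sub: "A (Suc k) (x(Suc k := y)) \<subseteq> A k x" for y
      unfolding A_def by (auto dest: spec[of _ "i::nat" for i])
    have "measure M B = (\<Sum>y\<in>succs S q (x k). measure M (A (Suc k) (x(Suc k := y))))"
      unfolding B_def
    proof (rule finite_measure_finite_Union)
      show "disjoint_family_on (\<lambda>y. A (Suc k) (x(Suc k := y))) (succs S q (x k))"
        unfolding disjoint_family_on_def A_def by force
    qed (use finite_succs[OF xk] in auto)
    also have "\<dots> = (\<Sum>y\<in>succs S q (x k). path_prob k x * (q (x k) y / exit_rate (x k)))"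
    proof (intro sum.cong refl)
      fix y assume "y \<in> succs S q (x k)"
      then have "measure M (A (Suc k) (x(Suc k := y))) = path_prob (Suc k) (x(Suc k := y))"
        using x by (intro prob_A) (auto simp: succs_states le_Suc_eq)
      then show "measure M (A (Suc k) (x(Suc k := y))) = path_prob k x * (q (x k) y / exit_rate (x k))"
        by (simp add: path_prob_extend)
    qed
    also have "\<dots> = path_prob k x"
      using exit_rate_pos[OF xk] exit_rate_eq[OF xk]
      by (simp flip: sum_distrib_left sum_divide_distrib)
    also have "\<dots> = measure M (A k x)"
      using x by (simp add: prob_A)
    finally have "measure M B = measure M (A k x)" .
    moreover have "B \<subseteq> A k x"
      using sub by (auto simp: B_def)
    ultimately have "measure M (A k x - B) = 0"
      by (simp add: finite_measure_Diff)
    then have "AE w in M. w \<notin> A k x - B"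
      by (intro AE_not_in) (auto simp: null_sets_def emeasure_eq_measure)
    then show ?thesis
      by eventually_elim (auto simp: B_def A_def)
  qed
  have first: "AE w in M. Z 0 w = a \<longrightarrow> 0 < T 0 w" if "a \<in> S" for a
  proof -
    have "measure M ({w \<in> space M. Z 0 w = a} - A 0 (\<lambda>_. a)) = 0"
      using prob_A[of 0 "\<lambda>_. a"] that
      by (subst finite_measure_Diff) (auto simp: A_def path_prob_def)
    then have "AE w in M. w \<notin> {w \<in> space M. Z 0 w = a} - A 0 (\<lambda>_. a)"
      by (intro AE_not_in) (auto simp: null_sets_def emeasure_eq_measure)
    then show ?thesis
      using AE_space by eventually_elim (auto simp: A_def)
  qed
  have "AE w in M. \<forall>a\<in>S. Z 0 w = a \<longrightarrow> 0 < T 0 w"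
    by (intro AE_ball_countable' first countable_states)
  moreover have "AE w in M. \<forall>k. \<forall>x\<in>PiE {..k} (\<lambda>_. S).
      w \<in> A k x \<longrightarrow> 0 < T (Suc k) w \<and> Z (Suc k) w \<in> succs S q (x k)"
    unfolding AE_all_countable
    using step countable_states
    by (intro allI AE_ball_countable' countable_PiE) (auto simp: PiE_def Pi_def)
  ultimately show ?thesis
    using AE_space
  proof eventually_elim
    case (elim w)
    define x where "x = (\<lambda>k. restrict (\<lambda>i. Z i w) {..k})"
    have x: "x k \<in> PiE {..k} (\<lambda>_. S)" for k
      using Z_in_states elim(3) by (auto simp: x_def)
    have "\<forall>i\<le>k. 0 < T i w" for k
    proof (induction k)
      case 0
      then show ?case
        using elim(1) Z_in_states[OF elim(3)] by auto
    next
      case (Suc k)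
      then have "w \<in> A k (x k)"
        using elim(3) by (auto simp: A_def x_def)
      then show ?case
        using Suc elim(2) x[of k] by (auto simp: le_Suc_eq)
    qed
    moreover from this have "w \<in> A k (x k)" for k
      using elim(3) by (auto simp: A_def x_def)
    moreover have "x k k = Z k w" for k
      by (simp add: x_def)
    ultimately show ?case
      using elim(2) x by (metis order_refl)
  qed
qed

lemma AE_holding_time_pos: "AE w in M. 0 < T k w"
  using AE_regular_path by eventually_elim auto

text \<open>Given the first states of the path, the holding times are independent exponential variables. For
indicators of upper tails this is the defining property of the process; the factors are then
replaced by arbitrary ones one at a time. The bound \<open>g i t \<le> 1\<close> keeps the weight collected from the
other factors integrable.\<close>

lemma path_law:
  assumes x: "\<And>i. i \<le> k \<Longrightarrow> x i \<in> S"
    and g: "\<And>i. g i \<in> borel_measurable borel" "\<And>i t. g i t \<le> (1::ennreal)"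
  shows "(\<integral>\<^sup>+w. indicator (cylinder k x) w * (\<Prod>i\<le>k. g i (T i w)) \<partial>M)
       = ennreal (path_prob k x) *
           (\<Prod>i\<le>k. \<integral>\<^sup>+t. ennreal (exponential_density (exit_rate (x i)) t) * g i t \<partial>lborel)"
proof -
  define \<mu> where "\<mu> = (\<lambda>i h. \<integral>\<^sup>+t. ennreal (exponential_density (exit_rate (x i)) t) * h t \<partial>lborel)"
  have \<mu>_finite: "\<mu> i h < \<infinity>" if "i \<le> k" "\<And>t. h t \<le> 1" for i h
  proof -
    have "\<mu> i h \<le> (\<integral>\<^sup>+t. ennreal (exponential_density (exit_rate (x i)) t) \<partial>lborel)"
      unfolding \<mu>_def using that(2) mult_left_mono by (intro nn_integral_mono) fastforce
    also have "\<dots> = 1"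
      using x that(1) exit_rate_pos by (intro nn_integral_exponential_density) auto
    finally show ?thesis
      using order_le_less_trans by fastforce
  qed
  have "(\<integral>\<^sup>+w. indicator (cylinder k x) w * (\<Prod>i\<le>k. g i (T i w)) \<partial>M)
      = ennreal (path_prob k x) * (\<Prod>i\<le>k. \<mu> i (g i))"
    if "m \<le> Suc k" "\<And>i. g i \<in> borel_measurable borel" "\<And>i t. g i t \<le> (1::ennreal)"
      "\<And>i. m \<le> i \<Longrightarrow> \<exists>s\<ge>0. g i = indicator {s<..}" for m g
    using that
  proof (induction m arbitrary: g)
    case 0
    then have "\<forall>i. \<exists>s. 0 \<le> s \<and> g i = indicator {s<..}"
      by auto
    from choice[OF this] obtain s where s: "\<And>i. 0 \<le> s i" "\<And>i. g i = indicator {s i<..}"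
      by auto
    have "(\<integral>\<^sup>+w. indicator (cylinder k x) w * (\<Prod>i\<le>k. g i (T i w)) \<partial>M)
        = (\<integral>\<^sup>+w. indicator {w \<in> space M. \<forall>i\<le>k. Z i w = x i \<and> T i w > s i} w \<partial>M)"
    proof (intro nn_integral_cong)
      fix w assume "w \<in> space M"
      moreover have "(\<Prod>i\<le>k. g i (T i w)) = (if \<forall>i\<le>k. T i w > s i then 1 else 0)"
        by (auto simp: s(2) indicator_def)
      ultimately show "indicator (cylinder k x) w * (\<Prod>i\<le>k. g i (T i w))
          = indicator {w \<in> space M. \<forall>i\<le>k. Z i w = x i \<and> T i w > s i} w"
        by (auto simp: cylinder_def indicator_def)
    qed
    also have "\<dots> = emeasure M {w \<in> space M. \<forall>i\<le>k. Z i w = x i \<and> T i w > s i}"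
      by (intro nn_integral_indicator) measurable
    also have "\<dots> = ennreal (path_prob k x * (\<Prod>i\<le>k. exp (- exit_rate (x i) * s i)))"
      unfolding emeasure_eq_measure by (subst finite_dim_law) (use x s in auto)
    also have "\<dots> = ennreal (path_prob k x) * (\<Prod>i\<le>k. ennreal (exp (- exit_rate (x i) * s i)))"
      using path_prob_nonneg[OF x] by (simp add: ennreal_mult' prod_ennreal prod_nonneg)
    also have "(\<Prod>i\<le>k. ennreal (exp (- exit_rate (x i) * s i))) = (\<Prod>i\<le>k. \<mu> i (g i))"
      unfolding \<mu>_def s(2)
      using x s(1) exit_rate_pos by (intro prod.cong refl nn_integral_exponential_tail[symmetric]) auto
    finally show ?case .
  next
    case (Suc m)
    note [measurable] = Suc.prems(2)
    have m: "m \<in> {..k}"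
      using Suc.prems(1) by simp
    define Y where "Y = (\<lambda>w. indicator (cylinder k x) w * (\<Prod>i\<in>{..k} - {m}. g i (T i w)) :: ennreal)"
    define c where "c = ennreal (path_prob k x) * (\<Prod>i\<in>{..k} - {m}. \<mu> i (g i))"
    have Y_split: "indicator (cylinder k x) w * (\<Prod>i\<le>k. (g(m := h)) i (T i w)) = Y w * h (T m w)"
      for h w
    proof -
      have "(\<Prod>i\<le>k. (g(m := h)) i (T i w)) = h (T m w) * (\<Prod>i\<in>{..k} - {m}. (g(m := h)) i (T i w))"
        using m by (subst prod.remove[of _ m]) auto
      also have "(\<Prod>i\<in>{..k} - {m}. (g(m := h)) i (T i w)) = (\<Prod>i\<in>{..k} - {m}. g i (T i w))"
        by (intro prod.cong) auto
      finally show ?thesis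
        by (simp add: Y_def mult_ac)
    qed
    have c_split: "ennreal (path_prob k x) * (\<Prod>i\<le>k. \<mu> i ((g(m := h)) i)) = c * \<mu> m h" for h
    proof -
      have "(\<Prod>i\<le>k. \<mu> i ((g(m := h)) i)) = \<mu> m h * (\<Prod>i\<in>{..k} - {m}. \<mu> i ((g(m := h)) i))"
        using m by (subst prod.remove[of _ m]) auto
      also have "(\<Prod>i\<in>{..k} - {m}. \<mu> i ((g(m := h)) i)) = (\<Prod>i\<in>{..k} - {m}. \<mu> i (g i))"
        by (intro prod.cong) auto
      finally show ?thesis
        by (simp add: c_def mult_ac)
    qed
    have "(\<integral>\<^sup>+w. Y w * g m (T m w) \<partial>M)
        = c * (\<integral>\<^sup>+t. ennreal (exponential_density (exit_rate (x m)) t) * g m t \<partial>lborel)"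
    proof (rule weighted_exponential_law)
      show "Y \<in> borel_measurable M"
        unfolding Y_def by measurable
      have "(\<Prod>i\<in>I. \<mu> i (g i)) < top" if "finite I" "I \<subseteq> {..k}" for I
        using that
      proof (induction I)
        case (insert i I)
        have "\<mu> i (g i) < top"
          using \<mu>_finite[of i "g i"] Suc.prems(3) insert.prems by simp
        then show ?case
          using insert by (simp add: ennreal_mult_less_top)
      qed simp
      then have "(\<Prod>i\<in>{..k} - {m}. \<mu> i (g i)) < top"
        by simp
      then show "c < \<infinity>"
        by (simp add: c_def ennreal_mult_less_top)
      show "0 < exit_rate (x m)"
        using m x exit_rate_pos by auto
      show "AE w in M. 0 < T m w"
        by (rule AE_holding_time_pos)
      fix s :: real assume s: "0 \<le> s"
      let ?h = "indicator {s<..} :: real \<Rightarrow> ennreal"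
      have "(\<integral>\<^sup>+w. Y w * ?h (T m w) \<partial>M) = c * \<mu> m ?h"
        unfolding Y_split[symmetric] c_split[symmetric]
      proof (rule Suc.IH)
        show "(g(m := ?h)) i \<in> borel_measurable borel" for i
          using Suc.prems(2) by auto
        show "(g(m := ?h)) i t \<le> 1" for i t
          using Suc.prems(3) by (auto simp: indicator_def)
        show "\<exists>s\<ge>0. (g(m := ?h)) i = indicator {s<..}" if "m \<le> i" for i
          using that s Suc.prems(4)[of i] by (cases "i = m") auto
      qed (use Suc.prems in auto)
      also have "\<mu> m ?h = ennreal (exp (- exit_rate (x m) * s))"
        unfolding \<mu>_def using m x s exit_rate_pos by (intro nn_integral_exponential_tail) auto
      finally show "(\<integral>\<^sup>+w. Y w * ?h (T m w) \<partial>M) = c * ennreal (exp (- exit_rate (x m) * s))" .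
    qed (use Suc.prems in auto)
    then show ?case
      using Y_split[of _ "g m"] c_split[of "g m"] by (simp add: \<mu>_def)
  qed
  note law = this
  define g' where "g' = (\<lambda>i. if i \<le> k then g i else indicator {0<..})"
  have "(\<integral>\<^sup>+w. indicator (cylinder k x) w * (\<Prod>i\<le>k. g' i (T i w)) \<partial>M)
      = ennreal (path_prob k x) * (\<Prod>i\<le>k. \<mu> i (g' i))"
  proof (rule law)
    show "g' i \<in> borel_measurable borel" for i
      using g by (auto simp: g'_def)
    show "g' i t \<le> 1" for i t
      using g by (auto simp: g'_def indicator_def)
    show "\<exists>s\<ge>0. g' i = indicator {s<..}" if "Suc k \<le> i" for i
      using that by (auto simp: g'_def)
  qed simp
  moreover have "(\<Prod>i\<le>k. g' i (T i w)) = (\<Prod>i\<le>k. g i (T i w))" for w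
    by (intro prod.cong) (auto simp: g'_def)
  moreover have "(\<Prod>i\<le>k. \<mu> i (g' i)) = (\<Prod>i\<le>k. \<mu> i (g i))"
    by (intro prod.cong) (auto simp: g'_def)
  ultimately show ?thesis
    by (simp add: \<mu>_def)
qed

section \<open>Lyapunov criteria for explosion and non-explosion\<close>

lemma integral_split_at_jump:
  assumes xk: "x k \<in> S" and H [measurable]: "H \<in> borel_measurable M"
  shows "(\<integral>\<^sup>+w. indicator (cylinder k x) w * H w \<partial>M)
       = (\<Sum>y\<in>succs S q (x k). \<integral>\<^sup>+w. indicator (cylinder (Suc k) (x(Suc k := y))) w * H w \<partial>M)"
proof -
  have "AE w in M. indicator (cylinder k x) w * H w
      = (\<Sum>y\<in>succs S q (x k). indicator (cylinder (Suc k) (x(Suc k := y))) w * H w)"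
    using AE_regular_path AE_space
  proof eventually_elim
    case (elim w)
    have next_ind: "indicator (cylinder (Suc k) (x(Suc k := y))) w
        = (indicator (cylinder k x) w * (if y = Z (Suc k) w then 1 else 0) :: ennreal)" for y
      using elim(2) by (auto simp: cylinder_def indicator_def le_Suc_eq)
    show ?case
    proof (cases "w \<in> cylinder k x")
      case True
      then have "Z (Suc k) w \<in> succs S q (x k)"
        using elim(1) by (auto simp: cylinder_def dest: spec[of _ k])
      then show ?thesis
        using True finite_succs[OF xk] by (simp add: next_ind if_distrib if_distribR sum.delta cong: if_cong)
    qed (simp add: next_ind)
  qed
  then have "(\<integral>\<^sup>+w. indicator (cylinder k x) w * H w \<partial>M)
      = (\<integral>\<^sup>+w. (\<Sum>y\<in>succs S q (x k). indicator (cylinder (Suc k) (x(Suc k := y))) w * H w) \<partial>M)"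
    by (rule nn_integral_cong_AE)
  then show ?thesis
    by (simp add: nn_integral_sum)
qed

lemma expected_holding_time:
  assumes x: "\<And>i. i \<le> k \<Longrightarrow> x i \<in> S"
  shows "(\<integral>\<^sup>+w. indicator (cylinder k x) w * ennreal (T k w) \<partial>M)
       = ennreal (path_prob k x / exit_rate (x k))"
proof -
  have r: "0 < exit_rate (x i)" if "i \<le> k" for i
    using exit_rate_pos x that by blast
  have "(\<integral>\<^sup>+w. indicator (cylinder k x) w * ennreal (T k w) \<partial>M)
      = ennreal (path_prob k x) *
        (\<integral>\<^sup>+t. ennreal (exponential_density (exit_rate (x k)) t) * ennreal t \<partial>lborel)"
  proof (rule weighted_exponential_law)
    fix s :: real assume s: "0 \<le> s"
    define g :: "nat \<Rightarrow> real \<Rightarrow> ennreal"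
      where "g = (\<lambda>i. if i = k then indicator {s<..} else (\<lambda>_. 1))"
    have "(\<integral>\<^sup>+w. indicator (cylinder k x) w * (\<Prod>i\<le>k. g i (T i w)) \<partial>M)
        = ennreal (path_prob k x) *
          (\<Prod>i\<le>k. \<integral>\<^sup>+t. ennreal (exponential_density (exit_rate (x i)) t) * g i t \<partial>lborel)"
      using x by (intro path_law) (auto simp: g_def indicator_def)
    moreover have "(\<Prod>i\<le>k. g i (T i w)) = indicator {s<..} (T k w)" for w
      by (simp add: g_def if_distribR prod.delta)
    moreover have "(\<Prod>i\<le>k. \<integral>\<^sup>+t. ennreal (exponential_density (exit_rate (x i)) t) * g i t \<partial>lborel)
        = (\<Prod>i\<le>k. if i = k then ennreal (exp (- exit_rate (x i) * s)) else 1)"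
      using r s by (intro prod.cong)
        (auto simp: g_def nn_integral_exponential_tail nn_integral_exponential_density)
    ultimately show "(\<integral>\<^sup>+w. indicator (cylinder k x) w * indicator {s<..} (T k w) \<partial>M)
        = ennreal (path_prob k x) * ennreal (exp (- exit_rate (x k) * s))"
      by simp
  qed (use r AE_holding_time_pos in auto)
  then show ?thesis
    using r[of k] path_prob_nonneg[OF x]
    by (simp add: nn_integral_exponential_mean ennreal_mult'[symmetric] del: times_divide_eq_right)
       (simp add: ennreal_mult'[symmetric])
qed

text \<open>Downward induction on \<open>j\<close>: the expected holding time at \<open>x j\<close> is the reciprocal of the exit rate,
and a drift of at most \<open>- \<epsilon>\<close> says precisely that the expectation of \<open>f / \<epsilon>\<close> falls by at least this
amount in one jump.\<close>

lemma expected_remaining_time: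
  assumes f: "\<And>x. x \<in> S \<Longrightarrow> 0 \<le> f x" and \<epsilon>: "0 < \<epsilon>"
    and drift: "\<And>x. x \<in> S \<Longrightarrow> generator S q f x \<le> - \<epsilon>"
    and "j \<le> k" and "\<And>i. i \<le> j \<Longrightarrow> x i \<in> S"
  shows "(\<integral>\<^sup>+w. indicator (cylinder j x) w * (\<Sum>i\<in>{j..<k}. ennreal (T i w)) \<partial>M)
       \<le> ennreal (path_prob j x * (f (x j) / \<epsilon>))"
  using assms(4,5)
proof (induction j arbitrary: x rule: inc_induct)
  case base
  then show ?case by simp
next
  case (step n)
  define p r where "p = path_prob n x" and "r = exit_rate (x n)"
  have xn: "x n \<in> S"
    using step.prems by simp
  have p: "0 \<le> p"
    unfolding p_def using step.prems by (intro path_prob_nonneg)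
  have r: "0 < r"
    unfolding r_def using xn by (rule exit_rate_pos)
  have "(\<integral>\<^sup>+w. indicator (cylinder n x) w * (\<Sum>i\<in>{n..<k}. ennreal (T i w)) \<partial>M)
      = (\<integral>\<^sup>+w. indicator (cylinder n x) w * ennreal (T n w)
          + indicator (cylinder n x) w * (\<Sum>i\<in>{Suc n..<k}. ennreal (T i w)) \<partial>M)"
    using step.hyps by (intro nn_integral_cong) (simp add: sum.atLeast_Suc_lessThan distrib_left)
  also have "\<dots> = (\<integral>\<^sup>+w. indicator (cylinder n x) w * ennreal (T n w) \<partial>M)
      + (\<integral>\<^sup>+w. indicator (cylinder n x) w * (\<Sum>i\<in>{Suc n..<k}. ennreal (T i w)) \<partial>M)"
    by (rule nn_integral_add) measurable
  also have "(\<integral>\<^sup>+w. indicator (cylinder n x) w * ennreal (T n w) \<partial>M) = ennreal (p / r)"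
    unfolding p_def r_def using step.prems by (rule expected_holding_time)
  also have "(\<integral>\<^sup>+w. indicator (cylinder n x) w * (\<Sum>i\<in>{Suc n..<k}. ennreal (T i w)) \<partial>M)
      = (\<Sum>y\<in>succs S q (x n). \<integral>\<^sup>+w. indicator (cylinder (Suc n) (x(Suc n := y))) w
          * (\<Sum>i\<in>{Suc n..<k}. ennreal (T i w)) \<partial>M)"
    by (rule integral_split_at_jump[where x = x and k = n, OF xn]) measurable
  also have "\<dots> \<le> (\<Sum>y\<in>succs S q (x n). ennreal (p * (q (x n) y / r) * (f y / \<epsilon>)))"
  proof (rule sum_mono)
    fix y assume y: "y \<in> succs S q (x n)"
    define x' where "x' = x(Suc n := y)"
    have "x' i \<in> S" if "i \<le> Suc n" for i
      using step.prems y that by (auto simp: x'_def succs_states le_Suc_eq)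
    then have "(\<integral>\<^sup>+w. indicator (cylinder (Suc n) x') w * (\<Sum>i\<in>{Suc n..<k}. ennreal (T i w)) \<partial>M)
        \<le> ennreal (path_prob (Suc n) x' * (f (x' (Suc n)) / \<epsilon>))"
      by (rule step.IH)
    then show "(\<integral>\<^sup>+w. indicator (cylinder (Suc n) (x(Suc n := y))) w
          * (\<Sum>i\<in>{Suc n..<k}. ennreal (T i w)) \<partial>M) \<le> ennreal (p * (q (x n) y / r) * (f y / \<epsilon>))"
      by (simp add: x'_def path_prob_extend p_def r_def)
  qed
  also have "\<dots> = ennreal (\<Sum>y\<in>succs S q (x n). p * (q (x n) y / r) * (f y / \<epsilon>))"
    using p r \<epsilon> f rates_nonneg[OF xn] by (intro sum_ennreal) (auto simp: succs_states)
  also have "ennreal (p / r) + \<dots> = ennreal (p / r + (\<Sum>y\<in>succs S q (x n). p * (q (x n) y / r) * (f y / \<epsilon>)))"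
    using p r \<epsilon> f rates_nonneg[OF xn]
    by (intro ennreal_plus[symmetric] sum_nonneg) (auto simp: succs_states)
  also have "\<dots> \<le> ennreal (p * (f (x n) / \<epsilon>))"
  proof (rule ennreal_leI)
    have "p / r + (\<Sum>y\<in>succs S q (x n). p * (q (x n) y / r) * (f y / \<epsilon>))
        = p / (r * \<epsilon>) * (\<epsilon> + (\<Sum>y\<in>succs S q (x n). q (x n) y * f y))"
      using \<epsilon> by (simp add: distrib_left sum_distrib_left mult_ac)
    also have "\<dots> \<le> p / (r * \<epsilon>) * (r * f (x n))"
      using p r \<epsilon> drift[OF xn] generator_eq[OF xn, of f]
      by (intro mult_left_mono) (auto simp: r_def)
    also have "\<dots> = p * (f (x n) / \<epsilon>)"
      using r by simp
    finally show "p / r + (\<Sum>y\<in>succs S q (x n). p * (q (x n) y / r) * (f y / \<epsilon>)) \<le> p * (f (x n) / \<epsilon>)" .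
  qed
  finally show ?case
    unfolding p_def by (simp add: add_left_mono)
qed

theorem explosion_criterion:
  assumes f: "\<And>x. x \<in> S \<Longrightarrow> 0 \<le> f x" and \<epsilon>: "0 < \<epsilon>"
    and drift: "\<And>x. x \<in> S \<Longrightarrow> generator S q f x \<le> - \<epsilon>"
  shows "explodes_almost_surely M T"
proof -
  have "AE w in M. Z 0 w = a \<longrightarrow> (\<Sum>i. ennreal (T i w)) \<noteq> \<infinity>" if a: "a \<in> S" for a
  proof -
    define C where "C = cylinder 0 (\<lambda>_. a)"
    have [measurable]: "C \<in> sets M"
      by (simp add: C_def)
    have "(\<integral>\<^sup>+w. (\<Sum>i. indicator C w * ennreal (T i w)) \<partial>M)
        = (\<Sum>i. \<integral>\<^sup>+w. indicator C w * ennreal (T i w) \<partial>M)"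
      by (rule nn_integral_suminf) measurable
    also have "\<dots> = (SUP k. \<Sum>i<k. \<integral>\<^sup>+w. indicator C w * ennreal (T i w) \<partial>M)"
      by (rule suminf_eq_SUP)
    also have "\<dots> \<le> ennreal (path_prob 0 (\<lambda>_. a) * (f a / \<epsilon>))"
    proof (rule SUP_least)
      fix k
      have "(\<Sum>i<k. \<integral>\<^sup>+w. indicator C w * ennreal (T i w) \<partial>M)
          = (\<integral>\<^sup>+w. indicator C w * (\<Sum>i\<in>{0..<k}. ennreal (T i w)) \<partial>M)"
        by (simp add: nn_integral_sum[symmetric] sum_distrib_left atLeast0LessThan)
      then show "(\<Sum>i<k. \<integral>\<^sup>+w. indicator C w * ennreal (T i w) \<partial>M)
          \<le> ennreal (path_prob 0 (\<lambda>_. a) * (f a / \<epsilon>))"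
        using expected_remaining_time[OF f \<epsilon> drift, of 0 k "\<lambda>_. a"] a by (simp add: C_def)
    qed
    also have "\<dots> < \<infinity>"
      by simp
    finally have "AE w in M. (\<Sum>i. indicator C w * ennreal (T i w)) \<noteq> \<infinity>"
      by (intro nn_integral_noteq_infinite) auto
    then show ?thesis
      using AE_space by eventually_elim (auto simp: C_def cylinder_def)
  qed
  then have "AE w in M. \<forall>a\<in>S. Z 0 w = a \<longrightarrow> (\<Sum>i. ennreal (T i w)) \<noteq> \<infinity>"
    by (intro AE_ball_countable' countable_states)
  then have "AE w in M. explosion T w"
    using AE_regular_path AE_space
  proof eventually_elim
    case (elim w)
    then have fin: "(\<Sum>i. ennreal (T i w)) \<noteq> \<infinity>"
      using Z_in_states by blast
    define t where "t = enn2real (\<Sum>i. ennreal (T i w))"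
    have "jump_time T k w \<le> t" for k
    proof -
      have "ennreal (jump_time T k w) = (\<Sum>i\<le>k. ennreal (T i w))"
        unfolding jump_time_def using elim(2) by (intro sum_ennreal[symmetric]) (auto simp: less_imp_le)
      also have "\<dots> \<le> (\<Sum>i. ennreal (T i w))"
        by (intro sum_le_suminf) auto
      also have "\<dots> = ennreal t"
        using fin by (simp add: t_def less_top)
      finally show ?thesis
        by (simp add: ennreal_le_iff t_def)
    qed
    then have "{k. jump_time T k w \<le> t} = UNIV"
      by auto
    then show ?case
      unfolding explosion_def by (intro exI[of _ t]) simp
  qed
  then show ?thesis
    by (simp add: explodes_almost_surely_def)
qed

lemma expected_discount:
  assumes c: "0 \<le> c" and x: "\<And>i. i \<le> k \<Longrightarrow> x i \<in> S"
  shows "(\<integral>\<^sup>+w. indicator (cylinder k x) w * (\<Prod>i<k. ennreal (exp (- c * max 0 (T i w)))) \<partial>M)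
       = ennreal (path_prob k x * (\<Prod>i<k. exit_rate (x i) / (exit_rate (x i) + c)))"
proof -
  define g :: "nat \<Rightarrow> real \<Rightarrow> ennreal"
    where "g = (\<lambda>i. if i = k then (\<lambda>_. 1) else (\<lambda>t. ennreal (exp (- c * max 0 t))))"
  have r: "0 < exit_rate (x i)" if "i \<le> k" for i
    using exit_rate_pos x that by blast
  have g_mean: "(\<integral>\<^sup>+t. ennreal (exponential_density (exit_rate (x i)) t) * g i t \<partial>lborel)
      = ennreal (exit_rate (x i) / (exit_rate (x i) + c))" if "i < k" for i
  proof -
    have "(\<integral>\<^sup>+t. ennreal (exponential_density (exit_rate (x i)) t) * g i t \<partial>lborel)
        = (\<integral>\<^sup>+t. ennreal (exponential_density (exit_rate (x i)) t) * ennreal (exp (- c * t)) \<partial>lborel)"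
      using that by (intro nn_integral_cong) (auto simp: g_def exponential_density_def max_def)
    then show ?thesis
      using r that c nn_integral_exponential_discount[of "exit_rate (x i)" c] by simp
  qed
  have last: "(\<integral>\<^sup>+t. ennreal (exponential_density (exit_rate (x k)) t) * g k t \<partial>lborel) = 1"
    using r by (simp add: g_def nn_integral_exponential_density)
  have "(\<integral>\<^sup>+w. indicator (cylinder k x) w * (\<Prod>i<k. ennreal (exp (- c * max 0 (T i w)))) \<partial>M)
      = (\<integral>\<^sup>+w. indicator (cylinder k x) w * (\<Prod>i\<le>k. g i (T i w)) \<partial>M)"
    by (simp add: lessThan_Suc_atMost[symmetric] g_def)
  also have "\<dots> = ennreal (path_prob k x) *
      (\<Prod>i\<le>k. \<integral>\<^sup>+t. ennreal (exponential_density (exit_rate (x i)) t) * g i t \<partial>lborel)"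
    using c x by (intro path_law) (auto simp: g_def ennreal_le_1)
  also have "\<dots> = ennreal (path_prob k x) * (\<Prod>i<k. ennreal (exit_rate (x i) / (exit_rate (x i) + c)))"
    using last g_mean by (simp add: lessThan_Suc_atMost[symmetric])
  also have "\<dots> = ennreal (path_prob k x * (\<Prod>i<k. exit_rate (x i) / (exit_rate (x i) + c)))"
  proof (subst prod_ennreal)
    show "0 \<le> exit_rate (x i) / (exit_rate (x i) + c)" if "i \<in> {..<k}" for i
      using r[of i] c that by auto
  qed (use path_prob_nonneg[OF x] in \<open>simp add: ennreal_mult'\<close>)
  finally show ?thesis .
qed

text \<open>One step of the discounted jump chain has the weights \<open>q x y / (exit_rate x + c)\<close>. The condition
\<open>generator S q f x \<le> c * f x\<close> makes \<open>f\<close> a supersolution for these weights, and their total mass is at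
most \<open>K / (K + c) < 1\<close> where \<open>f < R\<close>. Where \<open>f \<ge> R\<close>, the term \<open>f / R\<close> is at least the trivial
bound \<open>1\<close> for the discount still to come. Negative holding times, which form a null set, are cut off
by \<open>max 0\<close> so that every discount factor is at most \<open>1\<close>.\<close>

lemma expected_discount_le:
  assumes f: "\<And>x. x \<in> S \<Longrightarrow> 0 \<le> f x" and c: "0 < c" and R: "0 < R" and K: "0 < K"
    and drift: "\<And>x. x \<in> S \<Longrightarrow> generator S q f x \<le> c * f x"
    and bounded: "\<And>x. x \<in> S \<Longrightarrow> f x < R \<Longrightarrow> exit_rate x \<le> K"
    and "j \<le> k" and "\<And>i. i \<le> j \<Longrightarrow> x i \<in> S"
  shows "(\<integral>\<^sup>+w. indicator (cylinder j x) w * (\<Prod>i<k. ennreal (exp (- c * max 0 (T i w)))) \<partial>M)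
       \<le> ennreal (path_prob j x * (\<Prod>i<j. exit_rate (x i) / (exit_rate (x i) + c))
           * (f (x j) / R + (K / (K + c)) ^ (k - j)))"
  using assms(7,8)
proof (induction j arbitrary: x rule: inc_induct)
  case base
  let ?p = "path_prob k x * (\<Prod>i<k. exit_rate (x i) / (exit_rate (x i) + c))"
  have "0 \<le> ?p"
    using path_prob_nonneg[of k x] base exit_rate_pos c
    by (intro mult_nonneg_nonneg prod_nonneg ballI divide_nonneg_pos add_pos_pos) (auto simp: less_imp_le)
  then have "?p * 1 \<le> ?p * (f (x k) / R + 1)"
    using f[of "x k"] base R by (intro mult_left_mono) auto
  then show ?case
    using base c by (subst expected_discount) (auto intro!: ennreal_leI)
next
  case (step n)
  define D where "D = (\<lambda>i w. ennreal (exp (- c * max 0 (T i w))))"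
  have [measurable]: "D i \<in> borel_measurable M" for i
    unfolding D_def by measurable
  define r p \<theta> where "r = exit_rate (x n)"
    and "p = path_prob n x * (\<Prod>i<n. exit_rate (x i) / (exit_rate (x i) + c))"
    and "\<theta> = K / (K + c)"
  have xn: "x n \<in> S"
    using step.prems by simp
  have r: "0 < r"
    unfolding r_def using xn by (rule exit_rate_pos)
  have p: "0 \<le> p"
    unfolding p_def using path_prob_nonneg[of n x] step.prems exit_rate_pos c
    by (intro mult_nonneg_nonneg prod_nonneg ballI divide_nonneg_pos add_pos_pos) (auto simp: less_imp_le)
  have \<theta>: "0 \<le> \<theta>"
    using K c by (simp add: \<theta>_def)
  have "(\<integral>\<^sup>+w. indicator (cylinder n x) w * (\<Prod>i<k. D i w) \<partial>M) \<le> ennreal (p * (f (x n) / R + \<theta> ^ (k - n)))"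
  proof (cases "f (x n) < R")
    case False
    have "(\<Prod>i<k. D i w) \<le> (\<Prod>i<n. D i w)" for w
    proof -
      have "(\<Prod>i<k. D i w) = (\<Prod>i<n. D i w) * (\<Prod>i=n..<k. D i w)"
        using step.hyps prod.atLeastLessThan_concat[of 0 n k "\<lambda>i. D i w"]
        by (simp add: atLeast0LessThan)
      also have "\<dots> \<le> (\<Prod>i<n. D i w) * 1"
        using c by (intro mult_left_mono prod_le_1) (auto simp: D_def ennreal_le_1)
      finally show ?thesis by simp
    qed
    then have "(\<integral>\<^sup>+w. indicator (cylinder n x) w * (\<Prod>i<k. D i w) \<partial>M)
        \<le> (\<integral>\<^sup>+w. indicator (cylinder n x) w * (\<Prod>i<n. D i w) \<partial>M)"
      by (intro nn_integral_mono mult_left_mono) auto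
    also have "\<dots> = ennreal p"
      unfolding D_def p_def using c step.prems by (intro expected_discount) auto
    also have "\<dots> \<le> ennreal (p * (f (x n) / R + \<theta> ^ (k - n)))"
    proof (rule ennreal_leI)
      have "1 \<le> f (x n) / R + \<theta> ^ (k - n)"
        using False R \<theta> by (intro add_increasing2) (auto simp: field_simps)
      then show "p \<le> p * (f (x n) / R + \<theta> ^ (k - n))"
        using mult_left_mono[OF _ p] by fastforce
    qed
    finally show ?thesis .
  next
    case True
    define m where "m = k - Suc n"
    have km: "k - n = Suc m"
      using step.hyps by (simp add: m_def)
    have "(\<integral>\<^sup>+w. indicator (cylinder n x) w * (\<Prod>i<k. D i w) \<partial>M)
        = (\<Sum>y\<in>succs S q (x n). \<integral>\<^sup>+w. indicator (cylinder (Suc n) (x(Suc n := y))) w * (\<Prod>i<k. D i w) \<partial>M)"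
      by (rule integral_split_at_jump[where x = x and k = n, OF xn]) measurable
    also have "\<dots> \<le> (\<Sum>y\<in>succs S q (x n). ennreal (p * (q (x n) y / (r + c)) * (f y / R + \<theta> ^ m)))"
    proof (rule sum_mono)
      fix y assume y: "y \<in> succs S q (x n)"
      define x' where "x' = x(Suc n := y)"
      have "x' i \<in> S" if "i \<le> Suc n" for i
        using step.prems y that by (auto simp: x'_def succs_states le_Suc_eq)
      then have "(\<integral>\<^sup>+w. indicator (cylinder (Suc n) x') w * (\<Prod>i<k. D i w) \<partial>M)
          \<le> ennreal (path_prob (Suc n) x' * (\<Prod>i<Suc n. exit_rate (x' i) / (exit_rate (x' i) + c))
              * (f (x' (Suc n)) / R + \<theta> ^ m))"
        unfolding D_def \<theta>_def m_def by (rule step.IH)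
      also have "path_prob (Suc n) x' * (\<Prod>i<Suc n. exit_rate (x' i) / (exit_rate (x' i) + c))
          = p * (q (x n) y / (r + c))"
        using r by (simp add: x'_def path_prob_extend p_def r_def)
      finally show "(\<integral>\<^sup>+w. indicator (cylinder (Suc n) (x(Suc n := y))) w * (\<Prod>i<k. D i w) \<partial>M)
          \<le> ennreal (p * (q (x n) y / (r + c)) * (f y / R + \<theta> ^ m))"
        by (simp add: x'_def fun_upd_def)
    qed
    also have "\<dots> = ennreal (\<Sum>y\<in>succs S q (x n). p * (q (x n) y / (r + c)) * (f y / R + \<theta> ^ m))"
      using p r c R \<theta> f rates_nonneg[OF xn] by (intro sum_ennreal) (auto simp: succs_states)
    also have "\<dots> \<le> ennreal (p * (f (x n) / R + \<theta> ^ Suc m))"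
    proof (rule ennreal_leI)
      have "(\<Sum>y\<in>succs S q (x n). p * (q (x n) y / (r + c)) * (f y / R + \<theta> ^ m))
          = (\<Sum>y\<in>succs S q (x n). p * (q (x n) y * f y / (r + c) / R + q (x n) y / (r + c) * \<theta> ^ m))"
      proof (intro sum.cong refl)
        have "p * (a / (r + c)) * (b / R + \<theta> ^ m) = p * (a * b / (r + c) / R + a / (r + c) * \<theta> ^ m)" for a b
          using r c R by (simp add: divide_simps) (simp add: algebra_simps)
        then show "p * (q (x n) y / (r + c)) * (f y / R + \<theta> ^ m)
            = p * (q (x n) y * f y / (r + c) / R + q (x n) y / (r + c) * \<theta> ^ m)" for y .
      qed
      also have "\<dots> = p * ((\<Sum>y\<in>succs S q (x n). q (x n) y * f y) / (r + c) / R
              + (\<Sum>y\<in>succs S q (x n). q (x n) y) / (r + c) * \<theta> ^ m)"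
        by (simp only: sum_distrib_left[symmetric] sum.distrib sum_divide_distrib[symmetric]
            sum_distrib_right[symmetric])
      also have "\<dots> \<le> p * (f (x n) / R + \<theta> * \<theta> ^ m)"
      proof (intro mult_left_mono add_mono mult_right_mono divide_right_mono)
        show "(\<Sum>y\<in>succs S q (x n). q (x n) y * f y) / (r + c) \<le> f (x n)"
          using drift[OF xn] generator_eq[OF xn, of f] r c
          by (simp add: r_def divide_le_eq algebra_simps)
        have "r / (r + c) \<le> K / (K + c)"
          using bounded[OF xn True] r c K by (simp add: r_def field_simps)
        then show "(\<Sum>y\<in>succs S q (x n). q (x n) y) / (r + c) \<le> \<theta>"
          using exit_rate_eq[OF xn] by (simp add: r_def \<theta>_def)
      qed (use p R \<theta> in auto)
      finally show "(\<Sum>y\<in>succs S q (x n). p * (q (x n) y / (r + c)) * (f y / R + \<theta> ^ m))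
          \<le> p * (f (x n) / R + \<theta> ^ Suc m)"
        by simp
    qed
    finally show ?thesis
      by (simp add: km)
  qed
  then show ?case
    by (simp add: D_def p_def \<theta>_def)
qed

theorem non_explosion_criterion:
  assumes f: "\<And>x. x \<in> S \<Longrightarrow> 0 \<le> f x" and c: "0 < c"
    and drift: "\<And>x. x \<in> S \<Longrightarrow> generator S q f x \<le> c * f x"
    and bounded: "\<And>R. \<exists>K. \<forall>x\<in>S. f x < R \<longrightarrow> exit_rate x \<le> K"
  shows "non_explosive M T"
proof -
  define D where "D = (\<lambda>k w. \<Prod>i<k. ennreal (exp (- c * max 0 (T i w))))"
  have [measurable]: "D k \<in> borel_measurable M" for k
    unfolding D_def by measurable
  have "AE w in M. Z 0 w = a \<longrightarrow> (INF k. D k w) = 0" if a: "a \<in> S" for a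
  proof -
    define C where "C = cylinder 0 (\<lambda>_. a)"
    have [measurable]: "C \<in> sets M"
      by (simp add: C_def)
    let ?I = "\<integral>\<^sup>+w. indicator C w * (INF k. D k w) \<partial>M"
    have "?I \<le> ennreal e" if e: "0 < e" for e :: real
    proof -
      define R where "R = 2 * (f a + 1) / e"
      have R: "0 < R"
        using e f[OF a] by (simp add: R_def)
      have fR: "f a / R \<le> e / 2"
        using e f[OF a] by (simp add: R_def field_simps)
      obtain K0 where "\<forall>x\<in>S. f x < R \<longrightarrow> exit_rate x \<le> K0"
        using bounded by blast
      then have K: "0 < max 1 K0" "\<And>x. x \<in> S \<Longrightarrow> f x < R \<Longrightarrow> exit_rate x \<le> max 1 K0"
        by (auto simp: max.coboundedI2)
      define \<theta> where "\<theta> = max 1 K0 / (max 1 K0 + c)"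
      have "\<theta> < 1"
        using c K(1) by (simp add: \<theta>_def)
      then obtain k where k: "\<theta> ^ k < e / 2"
        using real_arch_pow_inv[of "e / 2" \<theta>] e by auto
      have "?I \<le> (\<integral>\<^sup>+w. indicator C w * D k w \<partial>M)"
        by (intro nn_integral_mono mult_left_mono INF_lower) auto
      also have "\<dots> \<le> ennreal (path_prob 0 (\<lambda>_. a) * (f a / R + \<theta> ^ k))"
        using expected_discount_le[OF f c R K(1) drift K(2), of 0 k "\<lambda>_. a"] a
        by (simp add: C_def D_def \<theta>_def)
      also have "\<dots> \<le> ennreal e"
      proof (rule ennreal_leI)
        have "path_prob 0 (\<lambda>_. a) \<le> 1" "0 \<le> path_prob 0 (\<lambda>_. a)"
          by (simp_all add: path_prob_def)
        moreover have "0 \<le> f a / R + \<theta> ^ k"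
          using f[OF a] R K(1) c by (simp add: \<theta>_def)
        ultimately have "path_prob 0 (\<lambda>_. a) * (f a / R + \<theta> ^ k) \<le> f a / R + \<theta> ^ k"
          by (simp add: mult_left_le_one_le)
        then show "path_prob 0 (\<lambda>_. a) * (f a / R + \<theta> ^ k) \<le> e"
          using fR k by linarith
      qed
      finally show ?thesis .
    qed
    note small = this
    have "?I \<le> 0"
      by (rule ennreal_le_epsilon) (simp add: small)
    then have "AE w in M. indicator C w * (INF k. D k w) = 0"
      by (simp add: nn_integral_0_iff_AE)
    then show ?thesis
      using AE_space by eventually_elim (auto simp: C_def cylinder_def)
  qed
  then have "AE w in M. \<forall>a\<in>S. Z 0 w = a \<longrightarrow> (INF k. D k w) = 0"
    by (intro AE_ball_countable' countable_states)
  then have "AE w in M. \<not> explosion T w"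
    using AE_regular_path AE_space
  proof eventually_elim
    case (elim w)
    show ?case
    proof
      assume "explosion T w"
      then obtain t where inf: "infinite {k. jump_time T k w \<le> t}"
        unfolding explosion_def by auto
      have "ennreal (exp (- c * t)) \<le> D k w" for k
      proof -
        obtain m where m: "k < m" "jump_time T m w \<le> t"
          using inf by (auto simp: infinite_nat_iff_unbounded)
        have "(\<Sum>i<k. T i w) \<le> jump_time T m w"
          unfolding jump_time_def using elim(2) m(1) by (intro sum_mono2) (auto simp: less_imp_le)
        then have "exp (- c * t) \<le> exp (- c * (\<Sum>i<k. T i w))"
          using m(2) c by simp
        also have "\<dots> = exp (\<Sum>i<k. - c * T i w)"
          by (simp only: sum_distrib_left)
        also have "\<dots> = (\<Prod>i<k. exp (- c * max 0 (T i w)))"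
          using elim(2) by (simp add: exp_sum max_absorb2 less_imp_le)
        finally show ?thesis
          unfolding D_def by (subst prod_ennreal) (auto intro: ennreal_leI)
      qed
      then have "ennreal (exp (- c * t)) \<le> (INF k. D k w)"
        by (rule INF_greatest)
      also have "\<dots> = 0"
        using elim Z_in_states by blast
      finally show False
        by simp
    qed
  qed
  then show ?thesis
    by (simp add: non_explosive_def)
qed

end

section \<open>The interacting birth-and-death process\<close>

definition crowd :: "'n::finite set set \<Rightarrow> ('n \<Rightarrow> nat) \<Rightarrow> 'n \<Rightarrow> real" where
  "crowd E \<xi> i = (\<Sum>j | adjacent E i j. real (\<xi> j))"

lemma adjacency_matrix_mult: "(adjacency_matrix E *v (\<chi> j. x j)) $ i = (\<Sum>j | adjacent E i j. x j)"
  by (simp add: matrix_vector_mult_def adjacency_matrix_def if_distrib if_distribR sum.If_cases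
      cong: if_cong)

lemma crowd_nonneg: "0 \<le> crowd E \<xi> i"
  by (simp add: crowd_def sum_nonneg)

lemma adjacent_sym: "adjacent E i j \<longleftrightarrow> adjacent E j i"
  by (simp add: adjacent_def insert_commute)

lemma not_adjacent_self: "simple_graph E \<Longrightarrow> \<not> adjacent E i i"
  by (auto simp: simple_graph_def adjacent_def)

lemma crowd_up:
  "crowd E (\<xi>(i := \<xi> i + 1)) j = crowd E \<xi> j + (if adjacent E j i then 1 else 0)"
proof -
  have "crowd E (\<xi>(i := \<xi> i + 1)) j = (\<Sum>k | adjacent E j k. real (\<xi> k) + (if k = i then 1 else 0))"
    unfolding crowd_def by (intro sum.cong) auto
  also have "\<dots> = crowd E \<xi> j + (if adjacent E j i then 1 else 0)"
    by (simp add: sum.distrib crowd_def)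
  finally show ?thesis .
qed

lemma birth_rate_finite:
  "birth_rate \<alpha> (ereal b) E \<xi> i = exp (\<alpha> * real (\<xi> i) + b * crowd E \<xi> i)"
  unfolding birth_rate_def adjacency_matrix_mult crowd_def[symmetric] by (simp add: exp_ext_def)

lemma birth_rate_hard_core:
  "birth_rate \<alpha> (-\<infinity>) E \<xi> i = (if crowd E \<xi> i = 0 then exp (\<alpha> * real (\<xi> i)) else 0)"
  using crowd_nonneg[of E \<xi> i]
  unfolding birth_rate_def adjacency_matrix_mult crowd_def[symmetric]
  by (auto simp: exp_ext_def)

lemma birth_rate_nonneg: "0 \<le> birth_rate \<alpha> \<beta> E \<xi> i"
  by (simp add: birth_rate_def exp_ext_def)

lemma rate_nonneg: "0 \<le> rate \<alpha> \<beta> E \<xi> \<eta>"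
  by (auto simp: rate_def birth_rate_nonneg intro!: sum_nonneg)

lemma rate_nonzero_cases:
  assumes "rate \<alpha> \<beta> E \<xi> \<eta> \<noteq> 0"
  obtains (birth) i where "\<eta> = \<xi>(i := \<xi> i + 1)" "birth_rate \<alpha> \<beta> E \<xi> i \<noteq> 0"
    | (death) i where "\<eta> = \<xi>(i := \<xi> i - 1)" "0 < \<xi> i"
proof -
  obtain i where "(if \<eta> = \<xi>(i := \<xi> i + 1) then birth_rate \<alpha> \<beta> E \<xi> i else 0)
             + (if \<xi> i > 0 \<and> \<eta> = \<xi>(i := \<xi> i - 1) then 1 else 0) \<noteq> 0"
    using assms unfolding rate_def by (metis (no_types, lifting) sum.neutral)
  then show ?thesis
    using birth[of i] death[of i] by (auto split: if_splits)
qed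

text \<open>Only births under hard-core interaction could leave the state space, and a birth has rate \<open>0\<close> there
as soon as a neighbour is occupied.\<close>

lemma rate_leads_to_state:
  assumes \<xi>: "\<xi> \<in> state_space \<beta> E" and "rate \<alpha> \<beta> E \<xi> \<eta> \<noteq> 0" and "simple_graph E"
  shows "\<eta> \<in> state_space \<beta> E"
proof (cases "\<beta> = -\<infinity>")
  case True
  have \<xi>: "\<And>j k. adjacent E j k \<Longrightarrow> \<xi> j * \<xi> k = 0"
    using \<xi> True by (simp add: state_space_def)
  have "\<eta> j * \<eta> k = 0" if jk: "adjacent E j k" for j k
    using assms(2)
  proof (cases rule: rate_nonzero_cases)
    case (birth i)
    then have "crowd E \<xi> i = 0"
      using True by (simp add: birth_rate_hard_core split: if_splits)
    then have "\<xi> l = 0" if "adjacent E i l" for l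
      using that by (auto simp: crowd_def sum_nonneg_eq_0_iff)
    then show ?thesis
      using birth \<xi>[OF jk] jk not_adjacent_self[OF assms(3)] adjacent_sym[of E] by (auto simp: fun_upd_def)
  next
    case (death i)
    then show ?thesis
      using \<xi>[OF jk] by auto
  qed
  then show ?thesis
    using True by (simp add: state_space_def)
qed (simp add: state_space_def)

lemma finite_succs_rate: "finite (succs S (rate \<alpha> \<beta> E) \<xi>)"
proof (rule finite_subset)
  show "succs S (rate \<alpha> \<beta> E) \<xi> \<subseteq> range (\<lambda>i. \<xi>(i := \<xi> i + 1)) \<union> range (\<lambda>i. \<xi>(i := \<xi> i - 1))"
    by (auto simp: succs_def elim: rate_nonzero_cases)
qed simp

lemma sum_succs_rate:
  assumes "\<xi> \<in> state_space \<beta> E" "simple_graph E"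
  shows "(\<Sum>\<eta>\<in>succs (state_space \<beta> E) (rate \<alpha> \<beta> E) \<xi>. rate \<alpha> \<beta> E \<xi> \<eta> * g \<eta>)
       = (\<Sum>i\<in>UNIV. birth_rate \<alpha> \<beta> E \<xi> i * g (\<xi>(i := \<xi> i + 1))
                    + (if 0 < \<xi> i then g (\<xi>(i := \<xi> i - 1)) else 0))"
proof -
  define N where "N = range (\<lambda>i. \<xi>(i := \<xi> i + 1)) \<union> range (\<lambda>i. \<xi>(i := \<xi> i - 1))"
  have [simp]: "finite N"
    by (simp add: N_def)
  have "(\<Sum>\<eta>\<in>succs (state_space \<beta> E) (rate \<alpha> \<beta> E) \<xi>. rate \<alpha> \<beta> E \<xi> \<eta> * g \<eta>)
      = (\<Sum>\<eta>\<in>N. rate \<alpha> \<beta> E \<xi> \<eta> * g \<eta>)"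
  proof (intro sum.mono_neutral_left ballI)
    show "succs (state_space \<beta> E) (rate \<alpha> \<beta> E) \<xi> \<subseteq> N"
      by (auto simp: succs_def N_def elim: rate_nonzero_cases)
    show "rate \<alpha> \<beta> E \<xi> \<eta> * g \<eta> = 0" if "\<eta> \<in> N - succs (state_space \<beta> E) (rate \<alpha> \<beta> E) \<xi>" for \<eta>
      using that rate_leads_to_state[OF assms(1) _ assms(2)] by (auto simp: succs_def)
  qed simp
  also have "\<dots> = (\<Sum>\<eta>\<in>N. \<Sum>i\<in>UNIV. (if \<eta> = \<xi>(i := \<xi> i + 1) then birth_rate \<alpha> \<beta> E \<xi> i * g \<eta> else 0)
             + (if \<eta> = \<xi>(i := \<xi> i - 1) then (if 0 < \<xi> i then g \<eta> else 0) else 0))"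
    unfolding rate_def sum_distrib_right by (intro sum.cong refl) (auto simp: distrib_right)
  also have "\<dots> = (\<Sum>i\<in>UNIV. \<Sum>\<eta>\<in>N. (if \<eta> = \<xi>(i := \<xi> i + 1) then birth_rate \<alpha> \<beta> E \<xi> i * g \<eta> else 0)
             + (if \<eta> = \<xi>(i := \<xi> i - 1) then (if 0 < \<xi> i then g \<eta> else 0) else 0))"
    by (rule sum.swap)
  also have "\<dots> = (\<Sum>i\<in>UNIV. birth_rate \<alpha> \<beta> E \<xi> i * g (\<xi>(i := \<xi> i + 1))
                    + (if 0 < \<xi> i then g (\<xi>(i := \<xi> i - 1)) else 0))"
    unfolding sum.distrib by (simp add: sum.delta N_def del: One_nat_def)
  finally show ?thesis .
qed

lemma generator_rate:
  assumes "\<xi> \<in> state_space \<beta> E" "simple_graph E"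
  shows "generator (state_space \<beta> E) (rate \<alpha> \<beta> E) f \<xi>
       = (\<Sum>i\<in>UNIV. birth_rate \<alpha> \<beta> E \<xi> i * (f (\<xi>(i := \<xi> i + 1)) - f \<xi>)
                    + (if 0 < \<xi> i then f (\<xi>(i := \<xi> i - 1)) - f \<xi> else 0))"
  unfolding generator_def by (rule sum_succs_rate[OF assms])

lemma total_rate_eq:
  assumes "\<xi> \<in> state_space \<beta> E" "simple_graph E"
  shows "total_rate (state_space \<beta> E) (rate \<alpha> \<beta> E) \<xi>
       = (\<Sum>i\<in>UNIV. birth_rate \<alpha> \<beta> E \<xi> i + (if 0 < \<xi> i then 1 else 0))"
  using sum_succs_rate[OF assms, of \<alpha> "\<lambda>_. 1"]
  by (simp add: total_rate_eq_sum_succs finite_succs_rate)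

lemma birth_rate_empty: "\<beta> < \<infinity> \<Longrightarrow> birth_rate \<alpha> \<beta> E (\<lambda>_. 0) i = 1"
  by (cases \<beta>) (auto simp: birth_rate_finite birth_rate_hard_core crowd_def)

lemma total_rate_pos:
  assumes "\<xi> \<in> state_space \<beta> E" "simple_graph E" "\<beta> < \<infinity>"
  shows "0 < total_rate (state_space \<beta> E) (rate \<alpha> \<beta> E) \<xi>"
proof -
  have nonneg: "0 \<le> birth_rate \<alpha> \<beta> E \<xi> i + (if 0 < \<xi> i then 1 else 0)" for i
    by (simp add: birth_rate_nonneg)
  have "\<exists>i. 0 < birth_rate \<alpha> \<beta> E \<xi> i + (if 0 < \<xi> i then 1 else 0)"
  proof (cases "\<exists>i. 0 < \<xi> i")
    case True
    then show ?thesis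
      using birth_rate_nonneg by (metis add_nonneg_pos zero_less_one)
  next
    case False
    then have "\<xi> = (\<lambda>_. 0)"
      by auto
    then show ?thesis
      using assms(3) by (simp add: birth_rate_empty)
  qed
  then show ?thesis
    unfolding total_rate_eq[OF assms(1,2)]
    using nonneg by (meson UNIV_I finite sum_pos2)
qed

lemma jump_process_rate:
  assumes "simple_graph E" "\<beta> < \<infinity>"
    and "ctmc M (state_space \<beta> E) (rate \<alpha> \<beta> E) Z T"
  shows "jump_process M (state_space \<beta> E) (rate \<alpha> \<beta> E) Z T"
proof
  show "countable (state_space \<beta> E)"
    by (rule countableI_type)
qed (use assms in \<open>auto simp: rate_nonneg finite_succs_rate total_rate_pos\<close>)

section \<open>Rayleigh quotients of symmetric matrices\<close>

lemma symmetric_inner: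
  fixes A :: "real^'n^'n"
  assumes "transpose A = A"
  shows "x \<bullet> (A *v y) = (A *v x) \<bullet> y"
  using assms by (metis dot_lmul_matrix transpose_matrix_vector)

text \<open>Eigenvectors for distinct eigenvalues are orthogonal, hence linearly independent. Finiteness is
what gives the maximum in \<open>largest_eigenvalue\<close> its meaning.\<close>

lemma finite_eigenvalues_symmetric:
  fixes A :: "real^'n^'n"
  assumes "transpose A = A"
  shows "finite {k. eigenvalue A k}"
proof -
  define ev where "ev = (\<lambda>k. SOME v. v \<noteq> 0 \<and> A *v v = k *\<^sub>R v)"
  have ev: "ev k \<noteq> 0 \<and> A *v ev k = k *\<^sub>R ev k" if "eigenvalue A k" for k
    unfolding ev_def using that[unfolded eigenvalue_def] by (rule someI_ex)
  have orth: "ev k \<bullet> ev l = 0" if "eigenvalue A k" "eigenvalue A l" "k \<noteq> l" for k l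
  proof -
    have "l * (ev k \<bullet> ev l) = k * (ev k \<bullet> ev l)"
      using symmetric_inner[OF assms, of "ev k" "ev l"] ev that by simp
    then show ?thesis
      using that by simp
  qed
  have "pairwise orthogonal (ev ` {k. eigenvalue A k})"
    using orth by (auto simp: pairwise_def orthogonal_def)
  moreover have "0 \<notin> ev ` {k. eigenvalue A k}"
    using ev by fastforce
  ultimately have "finite (ev ` {k. eigenvalue A k})"
    by (intro finiteI_independent pairwise_orthogonal_independent)
  moreover have "inj_on ev {k. eigenvalue A k}"
    using orth ev by (metis (mono_tags, lifting) inj_onI inner_eq_zero_iff mem_Collect_eq)
  ultimately show ?thesis
    by (rule finite_imageD)
qed

text \<open>The quadratic form attains its maximum \<open>m\<close> on the unit sphere at some \<open>v\<close>. The form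
\<open>m * (x \<bullet> x) - x \<bullet> (A *v x)\<close> is then nonnegative and vanishes at \<open>v\<close>, so its derivative at \<open>v\<close> is zero,
which is the eigenvector equation.\<close>

lemma rayleigh_maximum_eigenvalue:
  fixes A :: "real^'n^'n"
  assumes sym: "transpose A = A"
  obtains m where "eigenvalue A m" "\<And>x. x \<bullet> (A *v x) \<le> m * (x \<bullet> x)"
proof -
  have cont: "continuous_on (sphere 0 1) (\<lambda>x. x \<bullet> (A *v x))"
    by (intro continuous_intros matrix_vector_mult_linear_continuous_on)
  have nonempty: "sphere (0 :: real^'n) 1 \<noteq> {}"
    by simp
  obtain v where v: "v \<in> sphere 0 1"
    and max: "\<And>y. y \<in> sphere 0 1 \<Longrightarrow> y \<bullet> (A *v y) \<le> v \<bullet> (A *v v)"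
    using continuous_attains_sup[OF compact_sphere nonempty cont] by blast
  define m where "m = v \<bullet> (A *v v)"
  have v1: "v \<bullet> v = 1"
    using v by (simp add: norm_eq_1)
  have bound: "x \<bullet> (A *v x) \<le> m * (x \<bullet> x)" for x
  proof (cases "x = 0")
    case False
    define y where "y = x /\<^sub>R norm x"
    have x: "x = norm x *\<^sub>R y"
      using False by (simp add: y_def)
    have "y \<in> sphere 0 1"
      using False by (simp add: y_def)
    then have "y \<bullet> (A *v y) \<le> m"
      unfolding m_def by (rule max)
    then have "(norm x)\<^sup>2 * (y \<bullet> (A *v y)) \<le> (norm x)\<^sup>2 * m"
      by (intro mult_left_mono) auto
    moreover have "x \<bullet> (A *v x) = (norm x)\<^sup>2 * (y \<bullet> (A *v y))"
      by (subst (1 2) x) (simp add: matrix_vector_mult_scaleR power2_eq_square)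
    ultimately show ?thesis
      by (simp add: power2_norm_eq_inner mult.commute)
  qed simp
  have "(m *\<^sub>R v - A *v v) \<bullet> y = 0" for y
  proof -
    define B where "B = (m *\<^sub>R v - A *v v) \<bullet> y"
    define C where "C = m * (y \<bullet> y) - y \<bullet> (A *v y)"
    have C: "0 \<le> C"
      using bound[of y] by (simp add: C_def)
    have expand: "0 \<le> 2 * t * B + t\<^sup>2 * C" for t
      using bound[of "v + t *\<^sub>R y"] v1 symmetric_inner[OF sym, of v y]
      by (simp add: B_def C_def m_def matrix_vector_right_distrib matrix_vector_mult_scaleR
          inner_add_left inner_add_right inner_diff_left inner_commute power2_eq_square algebra_simps)
    define u where "u = B / (C + 1)"
    have B: "B = u * (C + 1)"
      using C by (simp add: u_def)
    have "2 * (- u) * B + (- u)\<^sup>2 * C = - (u\<^sup>2 * (C + 2))"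
      by (simp add: B power2_eq_square algebra_simps)
    then have "u\<^sup>2 * (C + 2) \<le> 0"
      using expand[of "- u"] by simp
    then have "u = 0"
      using C by (simp add: mult_le_0_iff)
    then show ?thesis
      using B by (simp add: B_def)
  qed
  then have "A *v v = m *\<^sub>R v"
    by (metis inner_eq_zero_iff right_minus_eq)
  moreover have "v \<noteq> 0"
    using v1 by auto
  ultimately have "eigenvalue A m"
    unfolding eigenvalue_def by blast
  with bound show thesis
    by (rule that[rotated])
qed

lemma transpose_adjacency_matrix: "transpose (adjacency_matrix E) = adjacency_matrix E"
  by (simp add: transpose_def adjacency_matrix_def adjacent_sym vec_eq_iff)

lemma adjacency_form_le:
  "x \<bullet> (adjacency_matrix E *v x) \<le> largest_eigenvalue E * (x \<bullet> x)"
proof -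
  obtain m where m: "eigenvalue (adjacency_matrix E) m"
    and le: "\<And>x. x \<bullet> (adjacency_matrix E *v x) \<le> m * (x \<bullet> x)"
    using rayleigh_maximum_eigenvalue[OF transpose_adjacency_matrix] by blast
  have "m \<le> largest_eigenvalue E"
    unfolding largest_eigenvalue_def
    using m by (intro Max_ge finite_eigenvalues_symmetric transpose_adjacency_matrix) auto
  then have "m * (x \<bullet> x) \<le> largest_eigenvalue E * (x \<bullet> x)"
    by (intro mult_right_mono) auto
  with le[of x] show ?thesis
    by linarith
qed

section \<open>Non-explosion\<close>

lemma non_explosive_bounded_rates:
  fixes E :: "'n::finite set set"
  assumes "simple_graph E" "\<beta> < \<infinity>" "ctmc M (state_space \<beta> E) (rate \<alpha> \<beta> E) Z T"
    and bound: "\<And>\<xi> i. birth_rate \<alpha> \<beta> E \<xi> i \<le> K"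
  shows "non_explosive M T"
proof -
  interpret jump_process M "state_space \<beta> E" "rate \<alpha> \<beta> E" Z T
    using assms(1-3) by (rule jump_process_rate)
  have "exit_rate \<xi> \<le> (\<Sum>i\<in>(UNIV::'n set). K + 1)" if "\<xi> \<in> state_space \<beta> E" for \<xi>
    unfolding total_rate_eq[OF that assms(1)] 
  proof (rule sum_mono)
    show "birth_rate \<alpha> \<beta> E \<xi> i + (if 0 < \<xi> i then 1 else 0) \<le> K + 1" for i
      using bound[of \<xi> i] by simp
  qed
  then show ?thesis
    by (intro non_explosion_criterion[of "\<lambda>_. 1" 1]) (auto simp: generator_def)
qed

lemma exp_times_linear_le: "exp v * (s + 1 - v) \<le> exp (s::real)"
proof -
  have "s + 1 - v \<le> exp (s - v)"
    using exp_ge_add_one_self[of "s - v"] by linarith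
  then have "exp v * (s + 1 - v) \<le> exp v * exp (s - v)"
    by (intro mult_left_mono) auto
  then show ?thesis
    by (simp add: mult_exp_exp)
qed

text \<open>The Lyapunov function is \<open>1 + Q / 2\<close> for the positive semidefinite form \<open>Q\<close> with matrix
$aI - bA$, where $a = -\alpha$. A birth at \<open>i\<close> changes \<open>Q / 2\<close> by \<open>a / 2 - v i\<close> and a death by
\<open>a / 2 + v i\<close>. At rates \<open>exp (v i)\<close> and \<open>1\<close> the sum of the two contributions is bounded above in
\<open>v i\<close>, whatever its sign. At criticality \<open>Q\<close> can vanish far away from the origin, so its sublevel
sets need not be finite, but the rates are bounded on them.\<close>

lemma non_explosive_subcritical:
  fixes E :: "'n::finite set set"
  assumes graph: "simple_graph E" and \<alpha>: "\<alpha> < 0" and b: "0 \<le> b"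
    and subcritical: "\<alpha> + b * largest_eigenvalue E \<le> 0"
    and "ctmc M (state_space (ereal b) E) (rate \<alpha> (ereal b) E) Z T"
  shows "non_explosive M T"
proof -
  interpret jump_process M "state_space (ereal b) E" "rate \<alpha> (ereal b) E" Z T
    using assms by (intro jump_process_rate) auto
  define A where "A = adjacency_matrix E"
  define a where "a = - \<alpha>"
  have a: "0 < a"
    using \<alpha> by (simp add: a_def)
  define Q where "Q = (\<lambda>x. a * (x \<bullet> x) - b * (x \<bullet> (A *v x)))"
  have Q_nonneg: "0 \<le> Q x" for x
  proof -
    have "b * (x \<bullet> (A *v x)) \<le> b * (largest_eigenvalue E * (x \<bullet> x))"
      unfolding A_def using b adjacency_form_le by (intro mult_left_mono) auto
    also have "\<dots> \<le> a * (x \<bullet> x)"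
      using subcritical mult_right_mono[of "b * largest_eigenvalue E" a "x \<bullet> x"]
      by (simp add: a_def)
    finally show ?thesis
      by (simp add: Q_def)
  qed
  define vec where "vec = (\<lambda>\<xi>. \<chi> i. real (\<xi> i) :: real^'n)"
  define v where "v = (\<lambda>\<xi> i. \<alpha> * real (\<xi> i) + b * crowd E \<xi> i)"
  have crowd: "(A *v vec \<xi>) $ i = crowd E \<xi> i" for \<xi> i
    by (simp add: A_def vec_def adjacency_matrix_mult crowd_def)
  have diag: "axis i 1 \<bullet> (A *v axis i 1) = 0" for i
    using not_adjacent_self[OF graph]
    by (simp add: inner_axis' matrix_vector_mult_basis column_def A_def adjacency_matrix_def)
  have Q_shift: "Q (vec \<xi> + t *\<^sub>R axis i 1) = Q (vec \<xi>) - 2 * t * v \<xi> i + t\<^sup>2 * a" for \<xi> t i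
  proof -
    have "vec \<xi> \<bullet> (A *v axis i 1) = crowd E \<xi> i" "axis i 1 \<bullet> (A *v vec \<xi>) = crowd E \<xi> i"
      using symmetric_inner[of A "vec \<xi>" "axis i 1"]
      by (simp_all add: A_def transpose_adjacency_matrix inner_axis inner_axis' crowd[unfolded A_def])
    moreover have "vec \<xi> \<bullet> axis i 1 = real (\<xi> i)" "axis i 1 \<bullet> vec \<xi> = real (\<xi> i)"
      by (simp_all add: vec_def inner_axis inner_axis')
    moreover have "axis i 1 \<bullet> (axis i 1 :: real^'n) = 1"
      by (simp add: inner_axis_axis)
    ultimately show ?thesis
      using diag[of i]
      by (simp add: Q_def v_def a_def matrix_vector_right_distrib matrix_vector_mult_scaleR
          inner_add_left inner_add_right power2_eq_square algebra_simps)
  qed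
  have up: "Q (vec (\<xi>(i := \<xi> i + 1))) = Q (vec \<xi>) - 2 * v \<xi> i + a" for \<xi> i
  proof -
    have "vec (\<xi>(i := \<xi> i + 1)) = vec \<xi> + 1 *\<^sub>R axis i 1"
      by (simp add: vec_def vec_eq_iff axis_def)
    then show ?thesis
      using Q_shift[of \<xi> 1 i] by simp
  qed
  have down: "Q (vec (\<xi>(i := \<xi> i - 1))) = Q (vec \<xi>) + 2 * v \<xi> i + a" if "0 < \<xi> i" for \<xi> i
  proof -
    have "vec (\<xi>(i := \<xi> i - 1)) = vec \<xi> + (- 1) *\<^sub>R axis i 1"
      using that by (simp add: vec_def vec_eq_iff axis_def of_nat_diff)
    then show ?thesis
      using Q_shift[of \<xi> "- 1" i] by simp
  qed
  define f where "f = (\<lambda>\<xi>. 1 + Q (vec \<xi>) / 2)"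
  have f_ge_1: "1 \<le> f \<xi>" for \<xi>
    using Q_nonneg by (simp add: f_def)
  \<comment> \<open>Nonnegativity of \<open>Q\<close> at its minimum \<open>t = v \<xi> i / a\<close> along the \<open>i\<close>-th axis.\<close>
  have v_bound: "(v \<xi> i)\<^sup>2 \<le> 2 * a * f \<xi>" for \<xi> i
  proof -
    have "0 \<le> Q (vec \<xi>) - 2 * (v \<xi> i / a) * v \<xi> i + (v \<xi> i / a)\<^sup>2 * a"
      using Q_nonneg Q_shift by metis
    then have "(v \<xi> i)\<^sup>2 \<le> a * Q (vec \<xi>)"
      using a by (simp add: field_simps power2_eq_square)
    also have "\<dots> \<le> 2 * a * f \<xi>"
      using a by (simp add: f_def algebra_simps)
    finally show ?thesis .
  qed
  define C where "C = exp (a / 2) + a / 2"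
  have C: "0 < C"
    using a by (simp add: C_def add_pos_pos)
  show ?thesis
  proof (rule non_explosion_criterion)
    show "0 \<le> f \<xi>" for \<xi>
      using f_ge_1[of \<xi>] by simp
    show "0 < real CARD('n) * C"
      using C by simp
    fix \<xi> assume \<xi>: "\<xi> \<in> state_space (ereal b) E"
    have "generator (state_space (ereal b) E) (rate \<alpha> (ereal b) E) f \<xi>
        = (\<Sum>i\<in>UNIV. exp (v \<xi> i) * (a / 2 - v \<xi> i) + (if 0 < \<xi> i then a / 2 + v \<xi> i else 0))"
      unfolding generator_rate[OF \<xi> graph] birth_rate_finite
    proof (intro sum.cong refl)
      fix i
      have "f (\<xi>(i := \<xi> i + 1)) - f \<xi> = a / 2 - v \<xi> i"
        unfolding f_def up by (simp add: diff_divide_distrib add_divide_distrib)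
      moreover have "f (\<xi>(i := \<xi> i - 1)) - f \<xi> = a / 2 + v \<xi> i" if "0 < \<xi> i"
        unfolding f_def down[of \<xi> i, OF that] by (simp add: diff_divide_distrib add_divide_distrib)
      ultimately show "exp (\<alpha> * real (\<xi> i) + b * crowd E \<xi> i) * (f (\<xi>(i := \<xi> i + 1)) - f \<xi>)
          + (if 0 < \<xi> i then f (\<xi>(i := \<xi> i - 1)) - f \<xi> else 0)
          = exp (v \<xi> i) * (a / 2 - v \<xi> i) + (if 0 < \<xi> i then a / 2 + v \<xi> i else 0)"
        by (auto simp: v_def)
    qed
    also have "\<dots> \<le> (\<Sum>i\<in>(UNIV::'n set). C)"
    proof (rule sum_mono)
      fix i
      have "exp (v \<xi> i) * (a / 2 - v \<xi> i) + exp (v \<xi> i) \<le> exp (a / 2)"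
        using exp_times_linear_le[of "v \<xi> i" "a / 2"] by (simp add: algebra_simps)
      moreover have "1 + v \<xi> i \<le> exp (v \<xi> i)" "0 < exp (v \<xi> i)"
        by (rule exp_ge_add_one_self) simp
      ultimately have "exp (v \<xi> i) * (a / 2 - v \<xi> i) + (a / 2 + v \<xi> i) \<le> C"
          "exp (v \<xi> i) * (a / 2 - v \<xi> i) \<le> C"
        using a unfolding C_def by linarith+
      then show "exp (v \<xi> i) * (a / 2 - v \<xi> i) + (if 0 < \<xi> i then a / 2 + v \<xi> i else 0) \<le> C"
        by simp
    qed
    also have "\<dots> = real CARD('n) * C * 1"
      by simp
    also have "\<dots> \<le> real CARD('n) * C * f \<xi>"
      using f_ge_1 C by (intro mult_left_mono) auto
    finally show "generator (state_space (ereal b) E) (rate \<alpha> (ereal b) E) f \<xi> \<le> real CARD('n) * C * f \<xi>" .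
  next
    fix R
    define B where "B = exp (sqrt (2 * a * \<bar>R\<bar>)) + 1"
    have "exit_rate \<xi> \<le> (\<Sum>i\<in>(UNIV::'n set). B)" if \<xi>: "\<xi> \<in> state_space (ereal b) E" and "f \<xi> < R" for \<xi>
      unfolding total_rate_eq[OF \<xi> graph]
    proof (rule sum_mono)
      fix i
      have "2 * a * f \<xi> \<le> 2 * a * \<bar>R\<bar>"
        using that(2) a by (intro mult_left_mono) auto
      with v_bound[of \<xi> i] have "(v \<xi> i)\<^sup>2 \<le> 2 * a * \<bar>R\<bar>"
        by (rule order_trans)
      then have "v \<xi> i \<le> sqrt (2 * a * \<bar>R\<bar>)"
        by (rule real_le_rsqrt)
      then show "birth_rate \<alpha> (ereal b) E \<xi> i + (if 0 < \<xi> i then 1 else 0) \<le> B"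
        unfolding birth_rate_finite B_def by (intro add_mono) (auto simp: v_def)
    qed
    then show "\<exists>K. \<forall>\<xi>\<in>state_space (ereal b) E. f \<xi> < R \<longrightarrow> exit_rate \<xi> \<le> K"
      by blast
  qed
qed

section \<open>Explosion through one rapidly growing vertex\<close>

text \<open>A function that is dominated by \<open>g\<close> and touches it at \<open>\<xi>\<close> has the smaller drift there. This allows
minima of Lyapunov functions.\<close>

lemma generator_rate_le:
  assumes \<xi>: "\<xi> \<in> state_space \<beta> E" and graph: "simple_graph E"
    and le: "\<And>\<eta>. f \<eta> \<le> g \<eta>" and eq: "f \<xi> = g \<xi>"
  shows "generator (state_space \<beta> E) (rate \<alpha> \<beta> E) f \<xi> \<le> generator (state_space \<beta> E) (rate \<alpha> \<beta> E) g \<xi>"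
  unfolding generator_def using le eq
  by (intro sum_mono mult_left_mono) (auto simp: rate_nonneg)

text \<open>The function \<open>\<phi> = exp (- g)\<close> increases under births. A birth at a vertex \<open>i\<close> of \<open>V\<close> lowers \<open>g\<close> by
\<open>(n + 1) * exp (- \<gamma> * \<xi> i)\<close>, so if \<open>i\<close> grows at rate at least \<open>exp (\<gamma> * \<xi> i)\<close>, then these births
alone raise \<open>\<phi>\<close> at speed at least \<open>(n + 1) * \<phi>\<close>. Deaths have total rate at most \<open>n\<close> and cannot
take away more than \<open>n * \<phi>\<close>. Since \<open>g\<close> is bounded, \<open>\<phi>\<close> is bounded away from \<open>0\<close> and \<open>1 - \<phi>\<close> satisfies
the explosion criterion.\<close>

lemma explodes_if_local_growth:
  fixes E :: "'n::finite set set" and V :: "'n set"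
  assumes "simple_graph E" "\<beta> < \<infinity>" "ctmc M (state_space \<beta> E) (rate \<alpha> \<beta> E) Z T"
    and \<gamma>: "0 < \<gamma>"
    and growth: "\<And>\<xi>. \<xi> \<in> state_space \<beta> E \<Longrightarrow> \<exists>i\<in>V. exp (\<gamma> * real (\<xi> i)) \<le> birth_rate \<alpha> \<beta> E \<xi> i"
  shows "explodes_almost_surely M T"
proof -
  interpret jump_process M "state_space \<beta> E" "rate \<alpha> \<beta> E" Z T
    using assms(1-3) by (rule jump_process_rate)
  define n where "n = real CARD('n)"
  define d where "d = 1 - exp (- \<gamma>)"
  define K where "K = (n + 1) / d"
  have n: "0 < n" and d: "0 < d"
    using \<gamma> by (simp_all add: n_def d_def)
  have K: "0 < K" "K * d = n + 1"
    using n d by (simp_all add: K_def)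
  define g where "g = (\<lambda>\<xi>. \<Sum>i\<in>V. K * exp (- \<gamma> * real (\<xi> i)))"
  define \<phi> where "\<phi> = (\<lambda>\<xi>. exp (- g \<xi>))"
  have g_nonneg: "0 \<le> g \<xi>" for \<xi>
    using K by (simp add: g_def sum_nonneg)
  have g_le: "g \<xi> \<le> real (card V) * K" for \<xi>
  proof -
    have "g \<xi> \<le> (\<Sum>i\<in>V. K)"
      unfolding g_def using K \<gamma> by (intro sum_mono) simp
    then show ?thesis
      by simp
  qed
  have g_up: "g (\<xi>(i := \<xi> i + 1)) = g \<xi> - (if i \<in> V then (n + 1) * exp (- \<gamma> * real (\<xi> i)) else 0)" for \<xi> i
  proof -
    have "g \<xi> - g (\<xi>(i := \<xi> i + 1))
        = (\<Sum>j\<in>V. if j = i then K * exp (- \<gamma> * real (\<xi> i)) - K * exp (- \<gamma> * real (\<xi> i + 1)) else 0)"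
      unfolding g_def sum_subtractf[symmetric] by (intro sum.cong) auto
    also have "\<dots> = (if i \<in> V then K * exp (- \<gamma> * real (\<xi> i)) - K * exp (- \<gamma> * real (\<xi> i + 1)) else 0)"
      by (simp add: sum.delta)
    also have "K * exp (- \<gamma> * real (\<xi> i)) - K * exp (- \<gamma> * real (\<xi> i + 1)) = K * d * exp (- \<gamma> * real (\<xi> i))"
    proof -
      have "exp (- \<gamma> * real (\<xi> i + 1)) = exp (- \<gamma> * real (\<xi> i)) * exp (- \<gamma>)"
        by (simp add: mult_exp_exp algebra_simps)
      then show ?thesis
        by (simp add: d_def algebra_simps)
    qed
    finally show ?thesis
      unfolding K(2) by linarith
  qed
  have \<phi>_le_1: "\<phi> \<xi> \<le> 1" for \<xi>
    using g_nonneg by (simp add: \<phi>_def)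
  have \<phi>_pos: "0 < \<phi> \<xi>" for \<xi>
    by (simp add: \<phi>_def)
  show ?thesis
  proof (rule explosion_criterion)
    show "0 \<le> 1 - \<phi> \<xi>" for \<xi>
      using \<phi>_le_1 by simp
    show "0 < exp (- real (card V) * K)"
      by simp
    fix \<xi> assume \<xi>: "\<xi> \<in> state_space \<beta> E"
    obtain i where i: "i \<in> V" "exp (\<gamma> * real (\<xi> i)) \<le> birth_rate \<alpha> \<beta> E \<xi> i"
      using growth[OF \<xi>] by blast
    let ?up = "\<lambda>j. birth_rate \<alpha> \<beta> E \<xi> j * ((1 - \<phi> (\<xi>(j := \<xi> j + 1))) - (1 - \<phi> \<xi>))"
    have births: "?up j \<le> (if j = i then - (n + 1) * \<phi> \<xi> else 0)" for j
    proof -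
      define s where "s = (if j \<in> V then (n + 1) * exp (- \<gamma> * real (\<xi> j)) else 0)"
      have s: "0 \<le> s"
        using n by (simp add: s_def)
      have up: "\<phi> (\<xi>(j := \<xi> j + 1)) = \<phi> \<xi> * exp s"
        unfolding \<phi>_def g_up s_def[symmetric] by (simp add: mult_exp_exp)
      have "birth_rate \<alpha> \<beta> E \<xi> j * (\<phi> \<xi> * s) \<le> birth_rate \<alpha> \<beta> E \<xi> j * (\<phi> \<xi> * (exp s - 1))"
      proof (intro mult_left_mono)
        show "s \<le> exp s - 1"
          using exp_ge_add_one_self[of s] by linarith
      qed (use birth_rate_nonneg \<phi>_pos in \<open>auto simp: less_imp_le\<close>)
      moreover have "(n + 1) * \<phi> \<xi> \<le> birth_rate \<alpha> \<beta> E \<xi> j * (\<phi> \<xi> * s)" if "j = i"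
      proof -
        have "(n + 1) * \<phi> \<xi> = exp (\<gamma> * real (\<xi> i)) * (\<phi> \<xi> * s)"
          using that i by (simp add: s_def exp_minus field_simps)
        also have "\<dots> \<le> birth_rate \<alpha> \<beta> E \<xi> i * (\<phi> \<xi> * s)"
          using i s \<phi>_pos by (intro mult_right_mono) (auto simp: less_imp_le)
        finally show ?thesis
          using that by simp
      qed
      moreover have "0 \<le> birth_rate \<alpha> \<beta> E \<xi> j * (\<phi> \<xi> * s)"
        using s \<phi>_pos birth_rate_nonneg by (intro mult_nonneg_nonneg) (auto simp: less_imp_le)
      ultimately show ?thesis
        unfolding up by (auto simp: algebra_simps)
    qed
    have deaths: "(if 0 < \<xi> j then (1 - \<phi> (\<xi>(j := \<xi> j - 1))) - (1 - \<phi> \<xi>) else 0) \<le> \<phi> \<xi>" for j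
      using \<phi>_pos[of "\<xi>(j := \<xi> j - 1)"] \<phi>_pos[of \<xi>] by (auto simp: less_imp_le)
    have "generator (state_space \<beta> E) (rate \<alpha> \<beta> E) (\<lambda>\<xi>. 1 - \<phi> \<xi>) \<xi>
        \<le> (\<Sum>j\<in>(UNIV::'n set). (if j = i then - (n + 1) * \<phi> \<xi> else 0) + \<phi> \<xi>)"
      unfolding generator_rate[OF \<xi> assms(1)] by (intro sum_mono add_mono births deaths)
    also have "\<dots> = - \<phi> \<xi>"
      by (simp add: sum.distrib n_def algebra_simps)
    also have "\<dots> \<le> - exp (- real (card V) * K)"
      using g_le by (simp add: \<phi>_def)
    finally show "generator (state_space \<beta> E) (rate \<alpha> \<beta> E) (\<lambda>\<xi>. 1 - \<phi> \<xi>) \<xi> \<le> - exp (- real (card V) * K)" .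
  qed
qed

section \<open>Explosion under competition\<close>

context
  fixes E :: "'n::finite set set" and \<alpha> b :: real
  assumes graph: "simple_graph E" and \<alpha>: "0 < \<alpha>" and b: "b < 0"
  notes One_nat_def [simp del]
begin

private definition log_rate :: "('n \<Rightarrow> nat) \<Rightarrow> 'n \<Rightarrow> real" where
  "log_rate \<xi> i = \<alpha> * real (\<xi> i) + b * crowd E \<xi> i"

text \<open>An upper bound for the total rate of all transitions other than a birth at \<open>i\<close>: the first summand
accounts for the deaths.\<close>

private definition rivals :: "('n \<Rightarrow> nat) \<Rightarrow> 'n \<Rightarrow> real" where
  "rivals \<xi> i = real CARD('n) + (\<Sum>j\<in>UNIV - {i}. exp (log_rate \<xi> j))"

private definition c :: real where
  "c = 2 / (1 - exp (- \<alpha>))"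

text \<open>A lower estimate of the probability that, from \<open>\<xi>\<close> on, all transitions are births at \<open>i\<close>. With
\<open>r = rivals \<xi> i * exp (- log_rate \<xi> i)\<close>, the next transition is a birth
at \<open>i\<close> with probability at least \<open>1 / (1 + r)\<close>, and such a birth multiplies \<open>r\<close> by at most
\<open>exp (- \<alpha>)\<close>. By \<open>1 + r \<le> exp r\<close> and a geometric series the probability is at least
\<open>exp (- r / (1 - exp (- \<alpha>)))\<close>; the factor \<open>2\<close> in \<open>c\<close> provides strict growth in the mean.\<close>

private definition \<phi> :: "'n \<Rightarrow> ('n \<Rightarrow> nat) \<Rightarrow> real" where
  "\<phi> i \<xi> = exp (- c * (rivals \<xi> i * exp (- log_rate \<xi> i)))"

private lemma log_rate_up: "log_rate (\<xi>(i := \<xi> i + 1)) j = log_rate \<xi> j + (if j = i then \<alpha> else 0) + (if adjacent E j i then b else 0)"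
  unfolding log_rate_def crowd_up by (simp add: algebra_simps)

private lemma log_rate_up_self: "log_rate (\<xi>(i := \<xi> i + 1)) i = log_rate \<xi> i + \<alpha>"
  using not_adjacent_self[OF graph] by (simp add: log_rate_up)

private lemma log_rate_down_le:
  assumes "0 < \<xi> j"
  shows "log_rate (\<xi>(j := \<xi> j - 1)) i \<le> log_rate \<xi> i - b"
  using log_rate_up[of "\<xi>(j := \<xi> j - 1)" j i] assms \<alpha> b by (auto split: if_splits)

private lemma c_ge_2: "2 \<le> c"
proof -
  have "exp (- \<alpha>) < 1"
    using \<alpha> by simp
  then show ?thesis
    unfolding c_def by (simp add: le_divide_eq)
qed

private lemma rivals_ge: "real CARD('n) \<le> rivals \<xi> i"
  by (simp add: rivals_def sum_nonneg)

private lemma rivals_pos: "0 < rivals \<xi> i"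
  using rivals_ge[of \<xi> i] by (rule less_le_trans[rotated]) simp

private lemma rivals_alt: "rivals \<xi> i = real CARD('n) + (\<Sum>j\<in>UNIV. exp (log_rate \<xi> j)) - exp (log_rate \<xi> i)"
  by (simp add: rivals_def sum_diff1)

private lemma \<phi>_pos: "0 < \<phi> i \<xi>"
  by (simp add: \<phi>_def)

private lemma \<phi>_le_1: "\<phi> i \<xi> \<le> 1"
  using c_ge_2 rivals_pos[of \<xi> i] by (simp add: \<phi>_def)

private lemma \<phi>_mono:
  assumes "log_rate \<xi> j \<le> log_rate \<xi> i"
  shows "\<phi> j \<xi> \<le> \<phi> i \<xi>"
proof -
  define s where "s = real CARD('n) + (\<Sum>j\<in>UNIV. exp (log_rate \<xi> j))"
  have r: "rivals \<xi> k * exp (- log_rate \<xi> k) = s * exp (- log_rate \<xi> k) - 1" for k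
    by (simp add: rivals_alt s_def left_diff_distrib mult_exp_exp)
  have "0 \<le> s"
    by (simp add: s_def sum_nonneg)
  then have "s * exp (- log_rate \<xi> i) \<le> s * exp (- log_rate \<xi> j)"
    using assms by (intro mult_left_mono) auto
  then show ?thesis
    unfolding \<phi>_def r using c_ge_2 by simp
qed

private lemma rivalry_up_self:
  "rivals (\<xi>(i := \<xi> i + 1)) i * exp (- log_rate (\<xi>(i := \<xi> i + 1)) i) \<le> exp (- \<alpha>) * (rivals \<xi> i * exp (- log_rate \<xi> i))"
proof -
  have "rivals (\<xi>(i := \<xi> i + 1)) i \<le> rivals \<xi> i"
    unfolding rivals_def using b by (intro add_left_mono sum_mono) (auto simp: log_rate_up)
  then have "rivals (\<xi>(i := \<xi> i + 1)) i * exp (- log_rate \<xi> i - \<alpha>) \<le> rivals \<xi> i * exp (- log_rate \<xi> i - \<alpha>)"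
    by (intro mult_right_mono) auto
  then show ?thesis
    unfolding log_rate_up_self by (simp add: exp_diff exp_minus field_simps)
qed

private lemma births_of_favourite:
  "exp (log_rate \<xi> i) * (\<phi> i \<xi> - \<phi> i (\<xi>(i := \<xi> i + 1))) \<le> - 2 * rivals \<xi> i * \<phi> i \<xi>"
  "exp (log_rate \<xi> i) * (1 - \<phi> i (\<xi>(i := \<xi> i + 1))) \<le> c * rivals \<xi> i"
proof -
  define r where "r = rivals \<xi> i * exp (- log_rate \<xi> i)"
  define r' where "r' = rivals (\<xi>(i := \<xi> i + 1)) i * exp (- log_rate (\<xi>(i := \<xi> i + 1)) i)"
  have r: "0 < r" "exp (log_rate \<xi> i) * r = rivals \<xi> i"
    using rivals_pos[of \<xi> i] by (simp_all add: r_def exp_minus field_simps)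
  have r'_le: "r' \<le> exp (- \<alpha>) * r"
    unfolding r_def r'_def by (rule rivalry_up_self)
  have "exp (- \<alpha>) < 1"
    using \<alpha> by simp
  then have "1 - exp (- \<alpha>) \<noteq> 0"
    by simp
  then have ca: "c * (1 - exp (- \<alpha>)) = 2"
    by (metis c_def nonzero_eq_divide_eq)
  have "2 * r = c * (1 - exp (- \<alpha>)) * r"
    by (simp only: ca)
  also have "\<dots> \<le> c * (r - r')"
    unfolding mult.assoc using c_ge_2 r'_le by (intro mult_left_mono) (simp_all add: algebra_simps)
  finally have "2 * r \<le> c * (r - r')" .
  then have "1 + 2 * r \<le> exp (c * (r - r'))"
    using exp_ge_add_one_self[of "c * (r - r')"] by linarith
  then have "\<phi> i \<xi> * (1 + 2 * r) \<le> \<phi> i \<xi> * exp (c * (r - r'))"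
    using \<phi>_pos[of i \<xi>] by (intro mult_left_mono) (auto simp: less_imp_le)
  also have "\<dots> = \<phi> i (\<xi>(i := \<xi> i + 1))"
    unfolding \<phi>_def r_def[symmetric] r'_def[symmetric] by (simp add: mult_exp_exp algebra_simps)
  finally have "\<phi> i \<xi> - \<phi> i (\<xi>(i := \<xi> i + 1)) \<le> - (2 * r * \<phi> i \<xi>)"
    by (simp add: algebra_simps)
  then have "exp (log_rate \<xi> i) * (\<phi> i \<xi> - \<phi> i (\<xi>(i := \<xi> i + 1))) \<le> exp (log_rate \<xi> i) * (- (2 * r * \<phi> i \<xi>))"
    by (intro mult_left_mono) auto
  also have "\<dots> = - 2 * (exp (log_rate \<xi> i) * r) * \<phi> i \<xi>"
    by (simp add: algebra_simps)
  finally show "exp (log_rate \<xi> i) * (\<phi> i \<xi> - \<phi> i (\<xi>(i := \<xi> i + 1))) \<le> - 2 * rivals \<xi> i * \<phi> i \<xi>"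
    by (simp only: r(2))
  have "r' \<le> r"
    using r'_le r(1) \<open>exp (- \<alpha>) < 1\<close> mult_right_mono[of "exp (- \<alpha>)" 1 r] by linarith
  moreover have "1 - c * r' \<le> \<phi> i (\<xi>(i := \<xi> i + 1))"
    unfolding \<phi>_def r'_def[symmetric] using exp_ge_add_one_self[of "- c * r'"] by linarith
  moreover have "c * r' \<le> c * r"
    using c_ge_2 \<open>r' \<le> r\<close> by (intro mult_left_mono) auto
  ultimately have "1 - \<phi> i (\<xi>(i := \<xi> i + 1)) \<le> c * r"
    by linarith
  then have "exp (log_rate \<xi> i) * (1 - \<phi> i (\<xi>(i := \<xi> i + 1))) \<le> exp (log_rate \<xi> i) * (c * r)"
    by (intro mult_left_mono) auto
  then show "exp (log_rate \<xi> i) * (1 - \<phi> i (\<xi>(i := \<xi> i + 1))) \<le> c * rivals \<xi> i"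
    by (simp add: r(2)[symmetric] mult_ac)
qed

text \<open>By \<open>births_of_favourite\<close> the births at \<open>i\<close> raise \<open>\<phi> i\<close> at least twice as fast as all other transitions can
lower it. This gives the first term on the right; the other two come from the change of the number
of particles in the factor \<open>P\<close>.\<close>

private lemma drift_estimate:
  fixes K :: real
  assumes K: "0 \<le> K"
  defines "P \<equiv> \<lambda>\<xi>. (\<Sum>j\<in>UNIV. real (\<xi> j)) + K"
  shows "generator (state_space (ereal b) E) (rate \<alpha> (ereal b) E) (\<lambda>\<xi>. P \<xi> * (1 - \<phi> i \<xi>)) \<xi>
      \<le> - P \<xi> * rivals \<xi> i * \<phi> i \<xi>
        + (\<Sum>j\<in>UNIV. exp (log_rate \<xi> j) * (1 - \<phi> i (\<xi>(j := \<xi> j + 1))))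
        - (\<Sum>j\<in>UNIV. if 0 < \<xi> j then 1 - \<phi> i (\<xi>(j := \<xi> j - 1)) else 0)"
proof -
  let ?h = "\<lambda>\<xi>. 1 - \<phi> i \<xi>"
  have state: "\<xi> \<in> state_space (ereal b) E"
    by (simp add: state_space_def)
  have P: "0 \<le> P \<xi>"
    using K by (simp add: P_def sum_nonneg)
  have P_up: "P (\<xi>(j := \<xi> j + 1)) = P \<xi> + 1" for \<xi> j
  proof -
    have "(\<Sum>k\<in>UNIV. real ((\<xi>(j := \<xi> j + 1)) k)) = (\<Sum>k\<in>UNIV. real (\<xi> k) + (if k = j then 1 else 0))"
      by (intro sum.cong) auto
    then show ?thesis
      by (simp add: P_def sum.distrib)
  qed
  have P_down: "P (\<xi>(j := \<xi> j - 1)) = P \<xi> - 1" if "0 < \<xi> j" for j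
    using P_up[of "\<xi>(j := \<xi> j - 1)" j] that by simp
  have gain: "exp (log_rate \<xi> j) * (\<phi> i \<xi> - \<phi> i (\<xi>(j := \<xi> j + 1)))
      \<le> (if j = i then - 2 * rivals \<xi> i * \<phi> i \<xi> - exp (log_rate \<xi> i) * \<phi> i \<xi> else 0) + exp (log_rate \<xi> j) * \<phi> i \<xi>" for j
  proof (cases "j = i")
    case True
    then show ?thesis
      using births_of_favourite(1)[of \<xi> i] by simp
  next
    case False
    then show ?thesis
      using \<phi>_pos[of i "\<xi>(j := \<xi> j + 1)"] by (simp add: right_diff_distrib less_imp_le)
  qed
  have "generator (state_space (ereal b) E) (rate \<alpha> (ereal b) E) (\<lambda>\<xi>. P \<xi> * ?h \<xi>) \<xi>
      = (\<Sum>j\<in>UNIV. P \<xi> * (exp (log_rate \<xi> j) * (\<phi> i \<xi> - \<phi> i (\<xi>(j := \<xi> j + 1))))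
          + exp (log_rate \<xi> j) * ?h (\<xi>(j := \<xi> j + 1))
          + (if 0 < \<xi> j then P \<xi> * (\<phi> i \<xi> - \<phi> i (\<xi>(j := \<xi> j - 1))) else 0)
          - (if 0 < \<xi> j then ?h (\<xi>(j := \<xi> j - 1)) else 0))"
    unfolding generator_rate[OF state graph] birth_rate_finite log_rate_def[symmetric]
  proof (intro sum.cong refl)
    fix j
    show "exp (log_rate \<xi> j) * (P (\<xi>(j := \<xi> j + 1)) * ?h (\<xi>(j := \<xi> j + 1)) - P \<xi> * ?h \<xi>)
          + (if 0 < \<xi> j then P (\<xi>(j := \<xi> j - 1)) * ?h (\<xi>(j := \<xi> j - 1)) - P \<xi> * ?h \<xi> else 0)
        = P \<xi> * (exp (log_rate \<xi> j) * (\<phi> i \<xi> - \<phi> i (\<xi>(j := \<xi> j + 1))))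
          + exp (log_rate \<xi> j) * ?h (\<xi>(j := \<xi> j + 1))
          + (if 0 < \<xi> j then P \<xi> * (\<phi> i \<xi> - \<phi> i (\<xi>(j := \<xi> j - 1))) else 0)
          - (if 0 < \<xi> j then ?h (\<xi>(j := \<xi> j - 1)) else 0)"
      unfolding P_up by (cases "0 < \<xi> j") (simp_all add: P_down algebra_simps)
  qed
  also have "\<dots> \<le> (\<Sum>j\<in>UNIV. P \<xi> * ((if j = i then - 2 * rivals \<xi> i * \<phi> i \<xi> - exp (log_rate \<xi> i) * \<phi> i \<xi> else 0)
            + exp (log_rate \<xi> j) * \<phi> i \<xi>)
          + exp (log_rate \<xi> j) * ?h (\<xi>(j := \<xi> j + 1))
          + P \<xi> * \<phi> i \<xi>
          - (if 0 < \<xi> j then ?h (\<xi>(j := \<xi> j - 1)) else 0))"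
  proof (intro sum_mono diff_mono add_mono order_refl)
    fix j
    show "P \<xi> * (exp (log_rate \<xi> j) * (\<phi> i \<xi> - \<phi> i (\<xi>(j := \<xi> j + 1))))
        \<le> P \<xi> * ((if j = i then - 2 * rivals \<xi> i * \<phi> i \<xi> - exp (log_rate \<xi> i) * \<phi> i \<xi> else 0) + exp (log_rate \<xi> j) * \<phi> i \<xi>)"
      using P gain by (intro mult_left_mono) auto
    have "P \<xi> * (\<phi> i \<xi> - \<phi> i (\<xi>(j := \<xi> j - 1))) \<le> P \<xi> * \<phi> i \<xi>"
      using P \<phi>_pos[of i "\<xi>(j := \<xi> j - 1)"] by (intro mult_left_mono) auto
    then show "(if 0 < \<xi> j then P \<xi> * (\<phi> i \<xi> - \<phi> i (\<xi>(j := \<xi> j - 1))) else 0) \<le> P \<xi> * \<phi> i \<xi>"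
      using P \<phi>_pos[of i \<xi>] by (auto simp: less_imp_le)
  qed
  also have "\<dots> = P \<xi> * \<phi> i \<xi> * (- 2 * rivals \<xi> i + (real CARD('n) + (\<Sum>j\<in>UNIV. exp (log_rate \<xi> j)) - exp (log_rate \<xi> i)))
        + (\<Sum>j\<in>UNIV. exp (log_rate \<xi> j) * ?h (\<xi>(j := \<xi> j + 1)))
        - (\<Sum>j\<in>UNIV. if 0 < \<xi> j then ?h (\<xi>(j := \<xi> j - 1)) else 0)"
    by (simp add: sum.distrib sum_subtractf distrib_left sum_distrib_left[symmetric] sum_distrib_right[symmetric])
      (simp add: algebra_simps)
  also have "real CARD('n) + (\<Sum>j\<in>UNIV. exp (log_rate \<xi> j)) - exp (log_rate \<xi> i) = rivals \<xi> i"
    by (simp add: rivals_alt)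
  also have "P \<xi> * \<phi> i \<xi> * (- 2 * rivals \<xi> i + rivals \<xi> i) = - P \<xi> * rivals \<xi> i * \<phi> i \<xi>"
    by (simp add: algebra_simps)
  finally show ?thesis .
qed

text \<open>Let \<open>i\<close> have the largest birth rate. If this rate is at least \<open>exp (- C)\<close>, then \<open>\<phi> i\<close> is at least a
constant \<open>\<delta>\<close>, and for large \<open>K\<close> the growth of \<open>\<phi> i\<close> outweighs the growth of the number of
particles. Otherwise all birth rates are tiny, \<open>\<phi> i\<close> is at most \<open>1 / 2\<close> after a death, and the
decrease of the number of particles gives the drift; some vertex is then occupied, as the birth
rates of the empty configuration are \<open>1\<close>.\<close>

private lemma negative_drift:
  obtains K where "0 \<le> K" "\<And>\<xi> i. (\<And>j. log_rate \<xi> j \<le> log_rate \<xi> i) \<Longrightarrow>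
    generator (state_space (ereal b) E) (rate \<alpha> (ereal b) E)
      (\<lambda>\<xi>. ((\<Sum>j\<in>UNIV. real (\<xi> j)) + K) * (1 - \<phi> i \<xi>)) \<xi> \<le> - 1 / 4"
proof -
  define n where "n = real CARD('n)"
  have "0 < CARD('n)"
    by simp
  then have n: "1 \<le> n"
    unfolding n_def by linarith
  \<comment> \<open>The term \<open>ln (4 * n)\<close> bounds the total birth rate by \<open>1 / 4\<close> in the second case. The term \<open>- b\<close>
    keeps the birth rate at \<open>i\<close> below \<open>1\<close> even after the death of a neighbour.\<close>
  define C where "C = ln (4 * n) - b"
  define \<delta> where "\<delta> = exp (- c * (n * (exp C + 1)))"
  define K where "K = (c + 2) / \<delta>"
  have \<delta>: "0 < \<delta>"
    by (simp add: \<delta>_def)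
  have K: "0 \<le> K" "K * \<delta> = c + 2"
    using \<delta> c_ge_2 by (simp_all add: K_def)
  have "generator (state_space (ereal b) E) (rate \<alpha> (ereal b) E)
      (\<lambda>\<xi>. ((\<Sum>j\<in>UNIV. real (\<xi> j)) + K) * (1 - \<phi> i \<xi>)) \<xi> \<le> - 1 / 4"
    if max: "\<And>j. log_rate \<xi> j \<le> log_rate \<xi> i" for \<xi> i
  proof -
    define P where "P = (\<Sum>j\<in>UNIV. real (\<xi> j)) + K"
    define B where "B = (\<Sum>j\<in>UNIV. exp (log_rate \<xi> j) * (1 - \<phi> i (\<xi>(j := \<xi> j + 1))))"
    define D where "D = (\<Sum>j\<in>UNIV. if 0 < \<xi> j then 1 - \<phi> i (\<xi>(j := \<xi> j - 1)) else 0)"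
    have P: "K \<le> P"
      by (simp add: P_def sum_nonneg)
    have R: "n \<le> rivals \<xi> i"
      unfolding n_def by (rule rivals_ge)
    have "- P * rivals \<xi> i * \<phi> i \<xi> + B - D \<le> - 1 / 4"
    proof (cases "- C \<le> log_rate \<xi> i")
      case True
      have "rivals \<xi> i \<le> n + (\<Sum>j\<in>UNIV - {i}. exp (log_rate \<xi> i))"
        unfolding rivals_def n_def using max by (intro add_left_mono sum_mono) auto
      also have "\<dots> \<le> n + n * exp (log_rate \<xi> i)"
        by (simp add: n_def card_Diff_singleton of_nat_diff Suc_leI)
      finally have "rivals \<xi> i * exp (- log_rate \<xi> i) \<le> (n + n * exp (log_rate \<xi> i)) * exp (- log_rate \<xi> i)"
        by (intro mult_right_mono) auto
      also have "\<dots> = n * (exp (- log_rate \<xi> i) + 1)"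
        by (simp add: algebra_simps mult_exp_exp)
      also have "\<dots> \<le> n * (exp C + 1)"
        using True n by (intro mult_left_mono) auto
      finally have "c * (rivals \<xi> i * exp (- log_rate \<xi> i)) \<le> c * (n * (exp C + 1))"
        using c_ge_2 by (intro mult_left_mono) auto
      then have "\<delta> \<le> \<phi> i \<xi>"
        by (simp add: \<phi>_def \<delta>_def)
      then have "c + 2 \<le> P * \<phi> i \<xi>"
        unfolding K(2)[symmetric] using P K(1) \<delta> by (intro mult_mono) auto
      then have "(c + 2) * rivals \<xi> i \<le> P * \<phi> i \<xi> * rivals \<xi> i"
        using rivals_pos[of \<xi> i] by (intro mult_right_mono) auto
      moreover have "B \<le> (c + 1) * rivals \<xi> i"
      proof -
        have "B \<le> (\<Sum>j\<in>UNIV. (if j = i then c * rivals \<xi> i - exp (log_rate \<xi> i) else 0) + exp (log_rate \<xi> j))"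
          unfolding B_def
        proof (rule sum_mono)
          fix j
          show "exp (log_rate \<xi> j) * (1 - \<phi> i (\<xi>(j := \<xi> j + 1)))
              \<le> (if j = i then c * rivals \<xi> i - exp (log_rate \<xi> i) else 0) + exp (log_rate \<xi> j)"
            using births_of_favourite(2)[of \<xi> i] \<phi>_pos[of i "\<xi>(j := \<xi> j + 1)"]
            by (auto simp: right_diff_distrib less_imp_le)
        qed
        also have "\<dots> = c * rivals \<xi> i - exp (log_rate \<xi> i) + (\<Sum>j\<in>UNIV. exp (log_rate \<xi> j))"
          by (simp add: sum.distrib)
        also have "\<dots> \<le> (c + 1) * rivals \<xi> i"
          unfolding distrib_right mult_1 by (subst (3) rivals_alt) simp
        finally show ?thesis .
      qed
      moreover have "0 \<le> D"
        unfolding D_def using \<phi>_le_1 by (intro sum_nonneg) auto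
      moreover have "1 \<le> rivals \<xi> i"
        using n R by linarith
      ultimately show ?thesis
        by (simp add: algebra_simps)
    next
      case False
      have vi: "exp (log_rate \<xi> i) \<le> 1 / (4 * n)"
      proof -
        have "exp (log_rate \<xi> i) \<le> exp (- ln (4 * n))"
          using False b by (simp add: C_def)
        then show ?thesis
          using n by (simp add: exp_minus inverse_eq_divide)
      qed
      have "B \<le> (\<Sum>j\<in>(UNIV::'n set). 1 / (4 * n))"
        unfolding B_def
      proof (rule sum_mono)
        fix j
        have "exp (log_rate \<xi> j) * (1 - \<phi> i (\<xi>(j := \<xi> j + 1))) \<le> exp (log_rate \<xi> j) * 1"
          using \<phi>_pos[of i "\<xi>(j := \<xi> j + 1)"] by (intro mult_left_mono) auto
        also have "\<dots> \<le> exp (log_rate \<xi> i)"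
          using max by simp
        finally show "exp (log_rate \<xi> j) * (1 - \<phi> i (\<xi>(j := \<xi> j + 1))) \<le> 1 / (4 * n)"
          using vi by linarith
      qed
      also have "\<dots> = 1 / 4"
        using n by (simp add: n_def)
      finally have B: "B \<le> 1 / 4" .
      have half: "1 / 2 \<le> 1 - \<phi> i (\<xi>(j := \<xi> j - 1))" if j: "0 < \<xi> j" for j
      proof -
        let ?\<eta> = "\<xi>(j := \<xi> j - 1)"
        have "log_rate ?\<eta> i \<le> log_rate \<xi> i - b"
          using j by (rule log_rate_down_le)
        also have "\<dots> \<le> 0"
          using False n ln_ge_zero[of "4 * n"] unfolding C_def by linarith
        finally have "1 \<le> exp (- log_rate ?\<eta> i)"
          by simp
        then have "1 * 1 \<le> rivals ?\<eta> i * exp (- log_rate ?\<eta> i)"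
          using n rivals_ge[of ?\<eta> i] by (intro mult_mono) (auto simp: n_def)
        then have "2 * 1 \<le> c * (rivals ?\<eta> i * exp (- log_rate ?\<eta> i))"
          using c_ge_2 by (intro mult_mono) auto
        then have "\<phi> i ?\<eta> \<le> exp (- 2)"
          by (simp add: \<phi>_def)
        also have "\<dots> \<le> 1 / 2"
          using exp_ge_add_one_self[of "2::real"] by (simp add: exp_minus field_simps)
        finally show ?thesis
          by simp
      qed
      have "\<exists>j. 0 < \<xi> j"
      proof (rule ccontr)
        assume "\<not> (\<exists>j. 0 < \<xi> j)"
        then have "log_rate \<xi> i = 0"
          by (simp add: log_rate_def crowd_def)
        then show False
          using False b n ln_ge_zero[of "4 * n"] unfolding C_def by linarith
      qed
      then obtain j where j: "0 < \<xi> j" ..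
      have "(\<Sum>j\<in>{j}. if 0 < \<xi> j then 1 - \<phi> i (\<xi>(j := \<xi> j - 1)) else 0) \<le> D"
        unfolding D_def using \<phi>_le_1 by (intro sum_mono2) auto
      then have "1 / 2 \<le> D"
        using half[OF j] j by simp
      moreover have "0 \<le> P * rivals \<xi> i * \<phi> i \<xi>"
        using P K(1) rivals_pos[of \<xi> i] \<phi>_pos[of i \<xi>] by (intro mult_nonneg_nonneg) (auto simp: less_imp_le)
      ultimately show ?thesis
        using B by (simp add: algebra_simps)
    qed
    then show ?thesis
      using drift_estimate[OF K(1), of i \<xi>] unfolding P_def B_def D_def by linarith
  qed
  with K(1) show thesis
    by (rule that)
qed

text \<open>At a configuration where \<open>i\<close> has the largest birth rate, \<open>\<phi> i\<close> is the largest of all \<open>\<phi> j\<close>, so the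
Lyapunov function with the maximum lies below the one with \<open>\<phi> i\<close> and touches it there; the drift
estimate for \<open>\<phi> i\<close> carries over.\<close>

lemma explodes_if_competition:
  assumes "ctmc M (state_space (ereal b) E) (rate \<alpha> (ereal b) E) Z T"
  shows "explodes_almost_surely M T"
proof -
  interpret jump_process M "state_space (ereal b) E" "rate \<alpha> (ereal b) E" Z T
    using graph assms by (intro jump_process_rate) auto
  obtain K where K: "0 \<le> K" and drift: "\<And>\<xi> i. (\<And>j. log_rate \<xi> j \<le> log_rate \<xi> i) \<Longrightarrow>
    generator (state_space (ereal b) E) (rate \<alpha> (ereal b) E)
      (\<lambda>\<xi>. ((\<Sum>j\<in>UNIV. real (\<xi> j)) + K) * (1 - \<phi> i \<xi>)) \<xi> \<le> - 1 / 4"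
    using negative_drift by blast
  define f where "f = (\<lambda>\<xi>. ((\<Sum>j\<in>UNIV. real (\<xi> j)) + K) * (1 - (MAX i. \<phi> i \<xi>)))"
  have P: "0 \<le> (\<Sum>j\<in>(UNIV::'n set). real (\<xi> j)) + K" for \<xi> :: "'n \<Rightarrow> nat"
    using K by (simp add: sum_nonneg)
  show ?thesis
  proof (rule explosion_criterion)
    show "0 \<le> f \<xi>" for \<xi>
      unfolding f_def using P[of \<xi>] \<phi>_le_1 by (intro mult_nonneg_nonneg) auto
    show "0 < (1 / 4 :: real)"
      by simp
    fix \<xi> assume \<xi>: "\<xi> \<in> state_space (ereal b) E"
    have "Max (range (log_rate \<xi>)) \<in> range (log_rate \<xi>)"
      by (intro Max_in) auto
    then obtain i where "Max (range (log_rate \<xi>)) = log_rate \<xi> i"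
      by (rule rangeE)
    then have i: "log_rate \<xi> j \<le> log_rate \<xi> i" for j
      using Max_ge[of "range (log_rate \<xi>)" "log_rate \<xi> j"] by simp
    have "(MAX j. \<phi> j \<xi>) = \<phi> i \<xi>"
      using \<phi>_mono[OF i] by (intro Max_eqI) auto
    then have "generator (state_space (ereal b) E) (rate \<alpha> (ereal b) E) f \<xi>
        \<le> generator (state_space (ereal b) E) (rate \<alpha> (ereal b) E)
            (\<lambda>\<xi>. ((\<Sum>j\<in>UNIV. real (\<xi> j)) + K) * (1 - \<phi> i \<xi>)) \<xi>"
      unfolding f_def using P by (intro generator_rate_le[OF \<xi> graph] mult_left_mono) auto
    also have "\<dots> \<le> - (1 / 4)"
      using drift[OF i] by simp
    finally show "generator (state_space (ereal b) E) (rate \<alpha> (ereal b) E) f \<xi> \<le> - (1 / 4)" .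
  qed
qed

end

theorem theorem6p1:
  fixes E :: "'n::finite set set"
    and \<alpha> :: real
    and \<beta> :: ereal
    and M :: "'w measure"
    and Z :: "nat \<Rightarrow> 'w \<Rightarrow> ('n \<Rightarrow> nat)"
    and T :: "nat \<Rightarrow> 'w \<Rightarrow> real"
  assumes "simple_graph E"
    and "\<beta> < \<infinity>"
    and "ctmc M (state_space \<beta> E) (rate \<alpha> \<beta> E) Z T"
  shows
    "((\<alpha> < 0 \<and> ereal \<alpha> + \<beta> * ereal (largest_eigenvalue E) \<le> 0
       \<or> \<alpha> = 0 \<and> \<beta> \<le> 0
       \<or> \<alpha> = 0 \<and> \<beta> > 0 \<and> edge_number E = 0)
        \<longrightarrow> non_explosive M T)
     \<and>
     ((\<alpha> > 0
       \<or> \<alpha> = 0 \<and> \<beta> > 0 \<and> edge_number E > 0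
       \<or> \<alpha> < 0 \<and> ereal \<alpha> + \<beta> * ereal (real (min_degree E)) > 0)
        \<longrightarrow> explodes_almost_surely M T)"
proof (intro conjI impI; (elim disjE conjE)?)
  have bounded: "non_explosive M T" if "\<And>\<xi> i. birth_rate \<alpha> \<beta> E \<xi> i \<le> 1"
    using non_explosive_bounded_rates[OF assms that] .
  have no_cooperation: "non_explosive M T" if \<alpha>: "\<alpha> \<le> 0" and \<beta>: "\<beta> \<le> 0"
  proof (rule bounded)
    fix \<xi> i
    have "b * crowd E \<xi> i \<le> 0" if "\<beta> = ereal b" for b
      using that \<beta> crowd_nonneg[of E \<xi> i] by (simp add: mult_nonpos_nonneg)
    moreover have "\<alpha> * real (\<xi> i) \<le> 0"
      using \<alpha> by (simp add: mult_nonpos_nonneg)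
    ultimately show "birth_rate \<alpha> \<beta> E \<xi> i \<le> 1"
      using assms(2) by (cases \<beta>) (auto simp: birth_rate_finite birth_rate_hard_core add_nonpos_nonpos)
  qed
  have growth: "explodes_almost_surely M T"
    if "0 < \<gamma>" "\<And>\<xi>. \<xi> \<in> state_space \<beta> E \<Longrightarrow> \<exists>i\<in>V. exp (\<gamma> * real (\<xi> i)) \<le> birth_rate \<alpha> \<beta> E \<xi> i" for \<gamma> V
    using explodes_if_local_growth[OF assms that] .
  {
    assume \<alpha>: "\<alpha> < 0" and sub: "ereal \<alpha> + \<beta> * ereal (largest_eigenvalue E) \<le> 0"
    show "non_explosive M T"
    proof (cases "\<beta> \<le> 0")
      case True
      then show ?thesis
        using \<alpha> by (intro no_cooperation) auto
    next
      case False
      then obtain b where b: "\<beta> = ereal b" "0 \<le> b"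
        using assms(2) by (cases \<beta>) auto
      then show ?thesis
        using non_explosive_subcritical[OF assms(1) \<alpha>, of b] sub assms(3) by simp
    qed
  next
    assume "\<alpha> = 0" "\<beta> \<le> 0"
    then show "non_explosive M T"
      by (intro no_cooperation) auto
  next
    assume \<alpha>: "\<alpha> = 0" and \<beta>: "0 < \<beta>" and "edge_number E = 0"
    then have "E = {}"
      by (simp add: edge_number_def)
    then have "crowd E \<xi> i = 0" for \<xi> i
      by (simp add: crowd_def adjacent_def)
    then show "non_explosive M T"
      using \<alpha> \<beta> assms(2) by (intro bounded) (cases \<beta>; simp add: birth_rate_finite)
  next
    assume \<alpha>: "0 < \<alpha>"
    consider "\<beta> = -\<infinity>" | b where "\<beta> = ereal b" "0 \<le> b" | b where "\<beta> = ereal b" "b < 0"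
      using assms(2) by (cases \<beta>) (auto simp: not_le[symmetric])
    then show "explodes_almost_surely M T"
    proof cases
      case 1
      show ?thesis
      proof (rule growth[OF \<alpha>])
        fix \<xi> assume "\<xi> \<in> state_space \<beta> E"
        then have \<xi>: "\<And>i j. adjacent E i j \<Longrightarrow> \<xi> i * \<xi> j = 0"
          using 1 by (simp add: state_space_def)
        have "\<exists>i. crowd E \<xi> i = 0"
        proof (cases "\<exists>i. 0 < \<xi> i")
          case True
          then obtain i where "0 < \<xi> i" ..
          then have "crowd E \<xi> i = 0"
            using \<xi>[of i] by (simp add: crowd_def)
          then show ?thesis ..
        qed (simp add: crowd_def)
        then show "\<exists>i\<in>UNIV. exp (\<alpha> * real (\<xi> i)) \<le> birth_rate \<alpha> \<beta> E \<xi> i"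
          using 1 by (auto simp: birth_rate_hard_core)
      qed
    next
      case (2 b)
      show ?thesis
        using 2 by (intro growth[OF \<alpha>, of UNIV]) (auto simp: birth_rate_finite crowd_nonneg)
    next
      case (3 b)
      then show ?thesis
        using explodes_if_competition[OF assms(1) \<alpha>, of b] assms(3) by simp
    qed
  next
    assume \<alpha>: "\<alpha> = 0" and \<beta>: "0 < \<beta>" and "0 < edge_number E"
    then obtain e where e: "e \<in> E"
      by (auto simp: edge_number_def card_gt_0_iff)
    then have "card e = 2"
      using assms(1) by (simp add: simple_graph_def)
    then obtain i j where ij: "e = {i, j}"
      by (auto simp: card_2_iff)
    have adj: "adjacent E i j" "adjacent E j i"
      using e ij by (simp_all add: adjacent_def insert_commute)
    obtain b where b: "\<beta> = ereal b" "0 < b"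
      using \<beta> assms(2) by (cases \<beta>) auto
    have le_crowd: "real (\<xi> l) \<le> crowd E \<xi> k" if "adjacent E k l" for \<xi> k l
      unfolding crowd_def using that by (intro member_le_sum) auto
    show "explodes_almost_surely M T"
    proof (rule growth[OF b(2)])
      fix \<xi> :: "'n \<Rightarrow> nat"
      have "real (\<xi> i) \<le> crowd E \<xi> i \<or> real (\<xi> j) \<le> crowd E \<xi> j"
        using le_crowd[OF adj(1), of \<xi>] le_crowd[OF adj(2), of \<xi>] by linarith
      then show "\<exists>k\<in>{i, j}. exp (b * real (\<xi> k)) \<le> birth_rate \<alpha> \<beta> E \<xi> k"
        using \<alpha> b by (auto simp: birth_rate_finite)
    qed
  next
    assume \<alpha>: "\<alpha> < 0" and super: "0 < ereal \<alpha> + \<beta> * ereal (real (min_degree E))"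
    obtain b where b: "\<beta> = ereal b"
      using \<alpha> super assms(2) by (cases \<beta>; cases "min_degree E = 0") auto
    define \<gamma> where "\<gamma> = \<alpha> + b * real (min_degree E)"
    have \<gamma>: "0 < \<gamma>"
      using super by (simp add: b \<gamma>_def)
    then have "0 < b"
      using \<alpha> by (simp add: \<gamma>_def) (meson add_nonpos_nonpos less_imp_le mult_nonpos_nonneg not_le of_nat_0_le_iff)
    show "explodes_almost_surely M T"
    proof (rule growth[OF \<gamma>])
      fix \<xi> :: "'n \<Rightarrow> nat"
      have "Min (range \<xi>) \<in> range \<xi>"
        by (intro Min_in) auto
      then obtain i where "Min (range \<xi>) = \<xi> i"
        by (rule rangeE)
      then have i: "\<xi> i \<le> \<xi> j" for j
        using Min_le[of "range \<xi>" "\<xi> j"] by simp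
      have "min_degree E \<le> vertex_degree E i"
        unfolding min_degree_def by simp
      then have "real (min_degree E) * real (\<xi> i) \<le> real (vertex_degree E i) * real (\<xi> i)"
        by (intro mult_right_mono) auto
      also have "\<dots> = (\<Sum>j | adjacent E i j. real (\<xi> i))"
        by (simp add: vertex_degree_def)
      also have "\<dots> \<le> crowd E \<xi> i"
        unfolding crowd_def using i by (intro sum_mono) simp
      finally have "b * (real (min_degree E) * real (\<xi> i)) \<le> b * crowd E \<xi> i"
        using \<open>0 < b\<close> by (intro mult_left_mono) auto
      then have "exp (\<gamma> * real (\<xi> i)) \<le> birth_rate \<alpha> \<beta> E \<xi> i"
        by (simp add: b birth_rate_finite \<gamma>_def algebra_simps)
      then show "\<exists>i\<in>UNIV. exp (\<gamma> * real (\<xi> i)) \<le> birth_rate \<alpha> \<beta> E \<xi> i"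
        by blast
    qed
  }
qed

end
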